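(* Let $r\ge 1$ be an integer, $\varepsilon>0$, and $\frac12+\frac{1}{2(2r+1)}<\delta<1$. Then for all sufficiently large integers $s$ we have \[ \mathbf{RT}_s(n,K_{s+r},n^\delta)=\Omega\big(n^{2-(1-\delta)/r-\varepsilon}\big) \] as $n\to\infty$.
   Context: For a graph $G$ and integer $s\ge 2$, the $s$-independence number $\alpha_s(G)$ is the maximum number of vertices of an induced subgraph of $G$ containing no copy of $K_s$. For a graph $H$ and a function $f=f(n)$, the Ramsey–Turán number $\mathbf{RT}_s(n,H,f)$ is the maximum number of edges of an $H$-free graph $G$ on $n$ vertices with $\alpha_s(G)<f$; if no such graph exists, $\mathbf{RT}_s(n,H,f)=0$. Asymptotic notation is as $n\to\infty$ with $r,s,\delta,\varepsilon$ fixed; implicit constants may depend on them. Rounding of $n^\delta$ is ignored. *)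

theory Defs
  imports Complex_Main "HOL-Library.Ramsey" "HOL-Library.Landau_Symbols"
begin

type_synonym 'a graph = "'a set \<times> 'a set set"

abbreviation verts :: "'a graph \<Rightarrow> 'a set" where "verts \<equiv> fst"
abbreviation edges :: "'a graph \<Rightarrow> 'a set set" where "edges \<equiv> snd"

definition simple_graph :: "'a graph \<Rightarrow> bool" where
  "simple_graph G \<longleftrightarrow> finite (verts G) \<and> edges G \<subseteq> nsets (verts G) 2"

definition complete_graph :: "nat \<Rightarrow> nat graph" where
  "complete_graph t = ({..<t}, nsets {..<t} 2)"

definition induced_subgraph :: "'a graph \<Rightarrow> 'a set \<Rightarrow> 'a graph" where
  "induced_subgraph G W = (W, edges G \<inter> Pow W)"

text \<open>Copies are subgraphs that need not be induced.\<close>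

definition contains_copy :: "'a graph \<Rightarrow> 'b graph \<Rightarrow> bool" where
  "contains_copy G H \<longleftrightarrow>
     (\<exists>\<phi>. inj_on \<phi> (verts H) \<and> \<phi> ` verts H \<subseteq> verts G \<and> (\<forall>e\<in>edges H. \<phi> ` e \<in> edges G))"

text \<open>For \<open>s \<ge> 1\<close> the empty set is always admissible, so the maximum is over a nonempty set.\<close>

definition s_independence_number :: "nat \<Rightarrow> 'a graph \<Rightarrow> nat" where
  "s_independence_number s G =
     Max {card W | W. W \<subseteq> verts G \<and> \<not> contains_copy (induced_subgraph G W) (complete_graph s)}"

text \<open>Graphs on \<open>n\<close> vertices are taken to have vertex set \<open>{..<n}\<close>. The bound \<open>f\<close> is real-valued,
  so that \<open>n\<^sup>\<delta>\<close> needs no rounding.\<close>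

definition RT_graphs :: "nat \<Rightarrow> nat \<Rightarrow> 'b graph \<Rightarrow> (nat \<Rightarrow> real) \<Rightarrow> nat graph set" where
  "RT_graphs s n H f =
     {G. simple_graph G \<and> verts G = {..<n} \<and> \<not> contains_copy G H \<and>
         real (s_independence_number s G) < f n}"

definition RT :: "nat \<Rightarrow> nat \<Rightarrow> 'b graph \<Rightarrow> (nat \<Rightarrow> real) \<Rightarrow> nat" where
  "RT s n H f =
     (if RT_graphs s n H f = {} then 0 else Max ((\<lambda>G. card (edges G)) ` RT_graphs s n H f))"

end

theory Submission
  imports Defs
    "HOL-Computational_Algebra.Primes"
    "HOL-Number_Theory.Cong"
    "HOL-Real_Asymp.Real_Asymp"
begin

text \<open>
  Take a prime \<open>q\<close> slightly below \<open>n\<^sup>\<delta>\<close>, identify the \<open>n\<close> vertices with points in few columns of the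
  affine plane of order \<open>q\<close>, and keep each of the \<open>q\<^sup>2\<close> non-vertical lines independently with probability
  \<open>1 / P\<close>, where \<open>P\<close> is about \<open>n\<^sup>a\<close> and \<open>a\<close> slightly exceeds \<open>(1 - \<delta>) / r\<close>. Colour the points of every
  kept line randomly with \<open>s\<close> colours and join two points if they have different colours on a kept line.
  A pair of points in different columns is then an edge with probability at least \<open>1 / (2 P)\<close>.

  By a second moment count half of all lines meet a given set of \<open>n\<^sup>\<delta>\<close> vertices in many points, and one
  of them is kept and shows all \<open>s\<close> colours, except with probability \<open>exp (- q\<^sup>2 / (4 P))\<close>. Since
  \<open>2 \<delta> - a > 1\<close>, which is what the lower bound on \<open>\<delta>\<close> says, this beats the number \<open>2\<^sup>n\<close> of sets.

  A line carries at most \<open>s\<close> points of a clique, so a clique of size \<open>s + r\<close> has \<open>r\<close> points off any line. If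
  one line contains \<open>k + r\<^sup>2\<close> points of the clique, then \<open>k\<close> of them see \<open>r\<close> points off the line along
  \<open>k r\<close> distinct lines, all of which are kept; as lines have about \<open>n / q < P\<^sup>r\<close> points, this is unlikely for
  a large constant \<open>k\<close>. Otherwise the clique spans a number of lines quadratic in \<open>s + r\<close>, all of which are
  kept, which is unlikely for large \<open>s\<close>.
\<close>

section \<open>Relative frequencies in finite product spaces\<close>

text \<open>Probability under the uniform distribution, written as a ratio of cardinalities, so that
  every probabilistic step below is finite counting.\<close>

definition freq :: "'a set \<Rightarrow> ('a \<Rightarrow> bool) \<Rightarrow> real" where
  "freq \<Omega> E = real (card {x \<in> \<Omega>. E x}) / real (card \<Omega>)"

lemma freq_nonneg: "freq \<Omega> E \<ge> 0"
  by (simp add: freq_def)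

lemma freq_mono:
  assumes "finite \<Omega>" "\<And>x. x \<in> \<Omega> \<Longrightarrow> E x \<Longrightarrow> F x"
  shows "freq \<Omega> E \<le> freq \<Omega> F"
  unfolding freq_def using assms by (intro divide_right_mono of_nat_mono card_mono) auto

lemma freq_disj:
  assumes "finite \<Omega>"
  shows "freq \<Omega> (\<lambda>x. E x \<or> F x) \<le> freq \<Omega> E + freq \<Omega> F"
proof -
  have "{x \<in> \<Omega>. E x \<or> F x} = {x \<in> \<Omega>. E x} \<union> {x \<in> \<Omega>. F x}" by auto
  then have "real (card {x \<in> \<Omega>. E x \<or> F x}) \<le> real (card {x \<in> \<Omega>. E x}) + real (card {x \<in> \<Omega>. F x})"
    by (metis card_Un_le of_nat_add of_nat_mono)
  then show ?thesis
    unfolding freq_def by (simp add: divide_right_mono flip: add_divide_distrib)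
qed

lemma freq_Bex:
  assumes "finite \<Omega>" "finite B" "\<And>b. b \<in> B \<Longrightarrow> freq \<Omega> (E b) \<le> c"
  shows "freq \<Omega> (\<lambda>x. \<exists>b\<in>B. E b x) \<le> real (card B) * c"
  using assms(2,3)
proof (induction B rule: finite_induct)
  case empty
  then show ?case by (simp add: freq_def)
next
  case (insert b B)
  have "freq \<Omega> (\<lambda>x. \<exists>b'\<in>insert b B. E b' x) \<le> freq \<Omega> (E b) + freq \<Omega> (\<lambda>x. \<exists>b\<in>B. E b x)"
    using freq_disj[OF assms(1), of "E b"] by simp
  also have "\<dots> \<le> c + real (card B) * c"
    using insert by (intro add_mono) auto
  finally show ?case
    using insert by (simp add: algebra_simps)
qed

lemma freq_not:
  assumes "finite \<Omega>" "\<Omega> \<noteq> {}"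
  shows "freq \<Omega> (\<lambda>x. \<not> E x) = 1 - freq \<Omega> E"
proof -
  have "card {x \<in> \<Omega>. E x} + card {x \<in> \<Omega>. \<not> E x} = card \<Omega>"
    using assms(1) by (subst card_Un_disjoint[symmetric]) (auto intro!: arg_cong[of _ _ card])
  moreover have "card \<Omega> > 0" using assms by (simp add: card_gt_0_iff)
  ultimately show ?thesis by (simp add: freq_def field_simps flip: of_nat_add)
qed

lemma freq_Times:
  assumes "finite A" "finite B"
  shows "freq (A \<times> B) (\<lambda>x. E (fst x) \<and> F (snd x)) = freq A E * freq B F"
proof -
  have "{x \<in> A \<times> B. E (fst x) \<and> F (snd x)} = {x \<in> A. E x} \<times> {x \<in> B. F x}" by auto
  then show ?thesis by (simp add: freq_def card_cartesian_product)
qed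

text \<open>Independence of the coordinates: the event is itself a product set, and each coordinate
  outside \<open>D\<close> contributes a factor \<open>1\<close>.\<close>

lemma freq_PiE:
  assumes "finite I" "D \<subseteq> I" "finite A" "A \<noteq> {}"
  shows "freq (I \<rightarrow>\<^sub>E A) (\<lambda>x. \<forall>i\<in>D. E i (x i)) = (\<Prod>i\<in>D. freq A (E i))"
proof -
  have "{x \<in> I \<rightarrow>\<^sub>E A. \<forall>i\<in>D. E i (x i)} = (\<Pi>\<^sub>E i\<in>I. {a \<in> A. i \<in> D \<longrightarrow> E i a})"
    using assms(2) by (auto simp: PiE_iff extensional_def)
  then have "freq (I \<rightarrow>\<^sub>E A) (\<lambda>x. \<forall>i\<in>D. E i (x i))
      = (\<Prod>i\<in>I. freq A (\<lambda>a. i \<in> D \<longrightarrow> E i a))"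
    using assms by (simp add: freq_def card_PiE prod_dividef)
  also have "\<dots> = (\<Prod>i\<in>D. freq A (E i))"
  proof (rule prod.mono_neutral_cong_right)
    show "\<forall>i\<in>I - D. freq A (\<lambda>a. i \<in> D \<longrightarrow> E i a) = 1"
      using assms by (simp add: freq_def)
  qed (use assms in auto)
  finally show ?thesis .
qed

text \<open>Double counting of the pairs \<open>(e, x)\<close> with \<open>E e x\<close>. If every
  good outcome had fewer than \<open>\<alpha> * card X / 2\<close> events, even crediting each bad
  outcome with all of \<open>X\<close> would leave too few pairs. This gives many edges and no bad
  event at once, without a concentration inequality.\<close>

lemma freq_average:
  assumes "finite \<Omega>" "\<Omega> \<noteq> {}" "finite X" "X \<noteq> {}" "\<alpha> > 0"
    and "\<And>e. e \<in> X \<Longrightarrow> freq \<Omega> (E e) \<ge> \<alpha>"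
    and "freq \<Omega> Bad < \<alpha> / 2"
  shows "\<exists>x\<in>\<Omega>. \<not> Bad x \<and> real (card {e \<in> X. E e x}) \<ge> \<alpha> * card X / 2"
proof (rule ccontr)
  assume *: "\<not> ?thesis"
  have pos: "real (card \<Omega>) > 0" "real (card X) > 0" using assms by (simp_all add: card_gt_0_iff)
  have "\<alpha> * card X * card \<Omega> \<le> (\<Sum>e\<in>X. freq \<Omega> (E e)) * card \<Omega>"
    using sum_bounded_below[of X \<alpha> "\<lambda>e. freq \<Omega> (E e)"] assms(6) pos by (simp add: mult.commute)
  also have "\<dots> = (\<Sum>e\<in>X. real (card {x\<in>\<Omega>. E e x}))"
    using pos by (simp add: freq_def flip: sum_divide_distrib)
  also have "\<dots> = real (\<Sum>e\<in>X. \<Sum>x\<in>\<Omega>. if E e x then 1 else 0)"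
    using assms(1) by (simp add: sum.If_cases Int_def)
  also have "\<dots> = (\<Sum>x\<in>\<Omega>. real (card {e\<in>X. E e x}))"
    using assms(3) by (subst sum.swap) (simp add: sum.If_cases Int_def)
  also have "\<dots> \<le> (\<Sum>x\<in>\<Omega>. \<alpha> * card X / 2 + (if Bad x then card X else 0))"
  proof (rule sum_mono)
    fix x assume "x \<in> \<Omega>"
    have "card {e\<in>X. E e x} \<le> card X" using assms(3) by (intro card_mono) auto
    then have "real (card {e\<in>X. E e x}) \<le> real (card X)" by simp
    moreover have "\<alpha> * card X / 2 \<ge> 0" using assms(5) by simp
    ultimately show "real (card {e\<in>X. E e x}) \<le> \<alpha> * card X / 2 + (if Bad x then card X else 0)"
      using * \<open>x \<in> \<Omega>\<close> by force
  qed
  also have "\<dots> = \<alpha> * card X / 2 * card \<Omega> + card X * real (card {x\<in>\<Omega>. Bad x})"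
    using assms(1) by (simp add: sum.distrib if_distrib[of real] sum.If_cases Int_def)
  also have "real (card {x\<in>\<Omega>. Bad x}) = freq \<Omega> Bad * card \<Omega>"
    using pos by (simp add: freq_def)
  also have "\<alpha> * card X / 2 * card \<Omega> + card X * (freq \<Omega> Bad * card \<Omega>)
      < \<alpha> * card X / 2 * card \<Omega> + card X * (\<alpha> / 2 * card \<Omega>)"
    using assms(7) pos by (intro add_strict_left_mono mult_strict_left_mono mult_strict_right_mono) auto
  finally show False by (simp add: field_simps)
qed

section \<open>Primes between powers\<close>

text \<open>The reciprocals of the numbers \<open>(n + 1) (n choose m)\<close> form Leibniz' harmonic triangle, in which
  every entry is an integer combination of \<open>1, 1/2, \<dots>, 1/(n + 1)\<close>.\<close>

lemma Suc_times_binomial_dvd: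
  fixes f :: nat
  assumes "\<And>i. 1 \<le> i \<Longrightarrow> i \<le> Suc n \<Longrightarrow> i dvd f" "m \<le> n"
  shows "(Suc n * (n choose m)) dvd f"
  using assms
proof (induction m arbitrary: n)
  case 0
  then show ?case by simp
next
  case (Suc m)
  then obtain n' where n: "n = Suc n'" and le: "m \<le> n'" by (cases n) auto
  define A B C where "A = n choose m" and "B = n' choose m" and "C = n choose Suc m"
  have "(Suc n * A) dvd f" using Suc unfolding A_def by simp
  moreover have "(n * B) dvd f" using Suc.IH[of n'] Suc.prems n le unfolding B_def by simp
  ultimately obtain a b where a: "f = Suc n * A * a" and b: "f = n * B * b"
    by (metis dvdE)
  have 1: "n * B = Suc m * C"
    using binomial_absorption[of m n] unfolding n B_def C_def by simp
  have 2: "(n - m) * A = n * B"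
    using binomial_absorb_comp[of n m] unfolding n A_def B_def by simp
  have "f * (n - m) = Suc n * (n * B) * a"
    unfolding a 2[symmetric] by (simp only: mult_ac)
  also have "\<dots> = Suc m * (Suc n * C * a)" unfolding 1 by (simp only: mult_ac)
  finally have 3: "Suc m * (Suc n * C * a) = f * (n - m)" by simp
  have "Suc m * (Suc n * C * b) = Suc n * f"
    unfolding b 1 by (simp only: mult_ac)
  also have "\<dots> = (Suc m + (n - m)) * f" using Suc.prems(2) by simp
  also have "\<dots> = Suc m * f + f * (n - m)"
    by (simp only: add_mult_distrib2 mult.commute[of _ f])
  also have "\<dots> = Suc m * (f + Suc n * C * a)"
    unfolding 3[symmetric] by (simp only: add_mult_distrib2)
  \<comment> \<open>Here \<open>a\<close> and \<open>b\<close> are the quotients of \<open>f\<close>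
    by \<open>Suc n * A\<close> and \<open>n * B\<close>, so \<open>b - a\<close> is its quotient by
    \<open>Suc n * C\<close>: the rule of the harmonic triangle, multiplied by
    \<open>f\<close>.\<close>
  finally have "Suc n * C * b = f + Suc n * C * a" by (metis mult_cancel1 nat.distinct(1))
  then have "(Suc n * C) dvd f + Suc n * C * a" by (metis dvd_triv_left)
  then show ?case unfolding C_def by (simp only: dvd_add_left_iff dvd_triv_left)
qed

text \<open>A Chebyshev bound. The product \<open>f\<close> of the largest prime powers up to
  \<open>Z\<close> is the least common multiple of \<open>1, ..., Z\<close>. Each factor is at most
  \<open>Z\<close>, and \<open>f\<close> is a multiple of
  \<open>Suc (2 * M) * ((2 * M) choose M)\<close>, which is at least \<open>2 ^ M\<close>.\<close>

lemma power_2_le_power_card_primes: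
  assumes "2 * M + 1 \<le> Z" "M > 0"
  shows "2 ^ M \<le> Z ^ card {p. prime p \<and> p \<le> Z}"
proof -
  define \<pi> where "\<pi> = {p. prime p \<and> p \<le> Z}"
  have fin: "finite \<pi>" unfolding \<pi>_def by (rule finite_subset[of _ "{..Z}"]) auto
  have "\<exists>k. p ^ k \<le> Z \<and> Z < p ^ (k + 1)" if "p \<in> \<pi>" for p
    using that assms ex_power_ivl1[of p Z] by (auto simp: \<pi>_def dest: prime_ge_2_nat)
  then obtain k where k: "\<And>p. p \<in> \<pi> \<Longrightarrow> p ^ k p \<le> Z \<and> Z < p ^ (k p + 1)" by metis
  define f where "f = (\<Prod>p\<in>\<pi>. p ^ k p)"
  have f_pos: "f > 0" unfolding f_def \<pi>_def by (intro prod_pos) (auto dest: prime_gt_0_nat)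
  have "i dvd f" if i: "1 \<le> i" "i \<le> Z" for i
  proof (rule multiplicity_le_imp_dvd)
    fix p :: nat assume p: "prime p"
    show "multiplicity p i \<le> multiplicity p f"
    proof (cases "p dvd i")
      case True
      then have "p \<in> \<pi>" using i p dvd_imp_le[of p i] by (auto simp: \<pi>_def)
      have "p ^ multiplicity p i \<le> Z"
        using i dvd_imp_le[OF multiplicity_dvd[of p i]] by simp
      then have "p ^ multiplicity p i < p ^ (k p + 1)" using k[OF \<open>p \<in> \<pi>\<close>] by linarith
      then have "multiplicity p i < k p + 1"
        by (rule power_less_imp_less_exp[OF prime_gt_1_nat[OF p]])
      moreover have "p ^ k p dvd f" unfolding f_def using fin \<open>p \<in> \<pi>\<close> by (rule dvd_prodI)
      then have "k p \<le> multiplicity p f"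
        using f_pos p by (intro multiplicity_geI) auto
      ultimately show ?thesis by simp
    qed (simp add: not_dvd_imp_multiplicity_0)
  qed (use f_pos i in auto)
  then have "(Suc (2 * M) * ((2 * M) choose M)) dvd f"
    using assms by (intro Suc_times_binomial_dvd) auto
  then have "Suc (2 * M) * ((2 * M) choose M) \<le> f" using f_pos by (intro dvd_imp_le)
  moreover have "2 ^ M \<le> Suc (2 * M) * ((2 * M) choose M)"
  proof -
    have "(2::real) ^ M \<le> 4 ^ M" by (intro power_mono) auto
    also have "4 ^ M / (2 * real M) \<le> real ((2 * M) choose M)"
      using central_binomial_lower_bound[OF assms(2)] .
    then have "4 ^ M \<le> real ((2 * M) choose M) * (2 * real M)" using assms(2) by (simp add: field_simps)
    also have "\<dots> \<le> real (Suc (2 * M) * ((2 * M) choose M))" by (simp add: algebra_simps)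
    finally have "real (2 ^ M) \<le> real (Suc (2 * M) * ((2 * M) choose M))" by simp
    then show ?thesis by (rule of_nat_le_iff[THEN iffD1])
  qed
  moreover have "f \<le> (\<Prod>p\<in>\<pi>. Z)" unfolding f_def using k by (intro prod_mono) auto
  ultimately show ?thesis unfolding \<pi>_def by (simp only: prod_constant)
qed

text \<open>Without such a prime, all primes up to \<open>x powr v\<close> would lie below
  \<open>x powr u\<close>, and the preceding bound would make \<open>x powr v\<close> at most of
  order \<open>x powr u * ln x\<close>.\<close>

lemma eventually_prime_between_powr:
  fixes u v :: real
  assumes "0 < u" "u < v"
  shows "\<forall>\<^sub>F n in sequentially. \<exists>q. prime q \<and> real n powr u \<le> real q \<and> real q \<le> real n powr v"
proof -
  \<comment> \<open>The factor \<open>(x powr v - 1) / 2 - 1\<close> is a lower bound for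
    \<open>M\<close> below; the subtracted terms absorb the two roundings.\<close>
  have "\<forall>\<^sub>F x::real in at_top. x powr u * (v * ln x) < ((x powr v - 1) / 2 - 1) * ln 2"
    using assms by real_asymp
  moreover have "\<forall>\<^sub>F x::real in at_top. x powr v > 5" using assms by real_asymp
  ultimately have "\<forall>\<^sub>F x::real in at_top. \<exists>q. prime q \<and> x powr u \<le> real q \<and> real q \<le> x powr v"
  proof eventually_elim
    case (elim x)
    define Z where "Z = nat \<lfloor>x powr v\<rfloor>"
    define M where "M = (Z - 1) div 2"
    have Z: "real Z \<le> x powr v" "x powr v < real Z + 1" unfolding Z_def using powr_ge_zero[of x v] by linarith+
    then have "Z \<ge> 5" using elim by linarith
    then have M: "2 * M + 1 \<le> Z" "M > 0" "Z \<le> 2 * M + 2" unfolding M_def by auto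
    show ?case
    proof (rule ccontr)
      assume *: "\<not> ?thesis"
      have "{p. prime p \<and> p \<le> Z} \<subseteq> {0<..nat \<lfloor>x powr u\<rfloor>}"
      proof safe
        fix p assume p: "prime p" "p \<le> Z"
        then have "real p \<le> x powr v" using Z by linarith
        then have "real p < x powr u" using * p(1) by (meson not_le)
        then show "p \<in> {0<..nat \<lfloor>x powr u\<rfloor>}" using prime_gt_0_nat[OF p(1)] by (auto simp: le_nat_floor)
      qed
      then have "card {p. prime p \<and> p \<le> Z} \<le> nat \<lfloor>x powr u\<rfloor>" using card_mono[OF finite_greaterThanAtMost] by (metis card_greaterThanAtMost diff_zero)
      then have c: "real (card {p. prime p \<and> p \<le> Z}) \<le> x powr u" using of_nat_floor[of "x powr u"] powr_ge_zero[of x u] by linarith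
      have "real (2 ^ M) \<le> real (Z ^ card {p. prime p \<and> p \<le> Z})"
        using power_2_le_power_card_primes[OF M(1,2)] by (rule of_nat_mono)
      then have "ln (2 ^ M) \<le> ln (real Z ^ card {p. prime p \<and> p \<le> Z})"
        using \<open>Z \<ge> 5\<close> by (intro ln_mono) auto
      then have "real M * ln 2 \<le> real (card {p. prime p \<and> p \<le> Z}) * ln Z"
        using \<open>Z \<ge> 5\<close> by (simp add: ln_realpow)
      also have "\<dots> \<le> x powr u * ln (x powr v)"
        using c Z \<open>Z \<ge> 5\<close> by (intro mult_mono ln_mono) auto
      also have "\<dots> = x powr u * (v * ln x)" by (simp add: ln_powr)
      also have "\<dots> < ((x powr v - 1) / 2 - 1) * ln 2" by (rule elim(1))
      also have "\<dots> \<le> real M * ln 2"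
      proof (rule mult_right_mono)
        have "real Z \<le> 2 * real M + 2" using M(3) by linarith
        then have "x powr v < 2 * real M + 3" using Z by linarith
        then show "(x powr v - 1) / 2 - 1 \<le> real M" by (simp add: field_simps)
      qed simp
      finally show False by simp
    qed
  qed
  then show ?thesis by (rule eventually_nat_real)
qed

section \<open>Random graphs on linear spaces\<close>

text \<open>An affine plane of order \<open>q\<close> without its vertical lines, restricted to the
  points in \<open>V\<close>. Two points need not be joined, since points of one column lie on no
  common line.\<close>

locale linear_space =
  fixes V :: "'v set" and L :: "'l set" and on :: "'v \<Rightarrow> 'l \<Rightarrow> bool" and q :: nat
  assumes finite_V: "finite V" and finite_L: "finite L"
    and line_unique: "\<lbrakk>u \<in> V; v \<in> V; u \<noteq> v; l \<in> L; l' \<in> L; on u l; on v l; on u l'; on v l'\<rbrakk> \<Longrightarrow> l = l'"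
    and card_lines_through: "v \<in> V \<Longrightarrow> card {l \<in> L. on v l} = q"
    and card_L: "card L = q\<^sup>2"
begin

section \<open>Incidence counts: how lines meet a large point set\<close>

lemma sum_card_line:
  assumes "M \<subseteq> V"
  shows "(\<Sum>l\<in>L. card {v \<in> M. on v l}) = q * card M"
proof -
  have fin: "finite M" using assms finite_V finite_subset by blast
  have "(\<Sum>l\<in>L. card {v \<in> M. on v l}) = (\<Sum>l\<in>L. \<Sum>v\<in>M. if on v l then 1 else 0)"
    using fin by (simp add: sum.If_cases Int_def)
  also have "\<dots> = (\<Sum>v\<in>M. card {l \<in> L. on v l})"
    using finite_L by (subst sum.swap) (simp add: sum.If_cases Int_def)
  also have "\<dots> = q * card M"
    using assms by (simp add: card_lines_through subset_iff)
  finally show ?thesis .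
qed

text \<open>Counts triples of two points of \<open>M\<close> and a line through both: distinct
  points have at most one such line, equal points have \<open>q\<close>.\<close>

lemma sum_card_line_squared:
  assumes "M \<subseteq> V"
  shows "(\<Sum>l\<in>L. (card {v \<in> M. on v l})\<^sup>2) \<le> (card M)\<^sup>2 + q * card M"
proof -
  have fin: "finite M" using assms finite_V finite_subset by blast
  have "(card {v \<in> M. on v l})\<^sup>2 = (\<Sum>u\<in>M. \<Sum>v\<in>M. if on u l \<and> on v l then 1 else 0)" for l
  proof -
    have "(card {v \<in> M. on v l})\<^sup>2 = (\<Sum>u\<in>M. if on u l then 1 else 0) * (\<Sum>v\<in>M. if on v l then 1 else 0)"
      using fin by (simp add: sum.If_cases Int_def power2_eq_square)
    also have "\<dots> = (\<Sum>u\<in>M. \<Sum>v\<in>M. (if on u l then 1 else 0) * (if on v l then 1 else 0))"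
      by (rule sum_product)
    also have "\<dots> = (\<Sum>u\<in>M. \<Sum>v\<in>M. if on u l \<and> on v l then 1 else 0)"
      by (intro sum.cong) auto
    finally show ?thesis .
  qed
  then have "(\<Sum>l\<in>L. (card {v \<in> M. on v l})\<^sup>2)
      = (\<Sum>l\<in>L. \<Sum>u\<in>M. \<Sum>v\<in>M. if on u l \<and> on v l then 1 else 0)" by simp
  also have "\<dots> = (\<Sum>u\<in>M. \<Sum>l\<in>L. \<Sum>v\<in>M. if on u l \<and> on v l then 1 else 0)"
    by (rule sum.swap)
  also have "\<dots> = (\<Sum>u\<in>M. \<Sum>v\<in>M. \<Sum>l\<in>L. if on u l \<and> on v l then 1 else 0)"
    by (intro sum.cong sum.swap refl)
  also have "\<dots> = (\<Sum>u\<in>M. \<Sum>v\<in>M. card {l \<in> L. on u l \<and> on v l})"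
    using finite_L by (simp add: sum.If_cases Int_def)
  also have "\<dots> \<le> (\<Sum>u\<in>M. \<Sum>v\<in>M. 1 + (if u = v then q else 0))"
  proof (intro sum_mono)
    fix u v assume uv: "u \<in> M" "v \<in> M"
    show "card {l \<in> L. on u l \<and> on v l} \<le> 1 + (if u = v then q else 0)"
    proof (cases "u = v")
      case True
      then show ?thesis using card_lines_through[of v] uv assms by auto
    next
      case False
      then have "card {l \<in> L. on u l \<and> on v l} \<le> Suc 0"
        using uv assms line_unique[of u v] finite_L by (subst card_le_Suc0_iff_eq) auto
      then show ?thesis using False by simp
    qed
  qed
  also have "\<dots> = (card M)\<^sup>2 + q * card M"
    using fin by (simp add: sum.distrib power2_eq_square algebra_simps del: Suc_eq_plus1 add_Suc plus_1_eq_Suc)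
  finally show ?thesis .
qed

text \<open>Chebyshev's inequality. Lines meet \<open>M\<close> in \<open>m / q\<close> points on
  average, and the squared deviations sum to at most \<open>q * m\<close>. A line below half the
  mean contributes at least \<open>(m / (2 * q))\<^sup>2\<close>, so there are at most
  \<open>4 * q ^ 3 / m\<close> of them, which is at most half of all lines once
  \<open>m \<ge> 8 * q\<close>.\<close>

lemma card_rich_lines:
  assumes "M \<subseteq> V" "8 * q \<le> card M" "q > 0"
  shows "real q ^ 2 / 2 \<le> card {l \<in> L. real (card M) / (2 * q) \<le> card {v \<in> M. on v l}}"
proof -
  define m where "m = real (card M)"
  define x where "x l = real (card {v \<in> M. on v l})" for l
  define poor where "poor = {l \<in> L. x l < m / (2 * q)}"
  have m: "m \<ge> 8 * q" "m > 0" using assms unfolding m_def by linarith+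
  have s1: "(\<Sum>l\<in>L. x l) = q * m"
    using sum_card_line[OF assms(1)] unfolding x_def m_def by (metis of_nat_mult of_nat_sum)
  have "real (\<Sum>l\<in>L. (card {v \<in> M. on v l})\<^sup>2) \<le> real ((card M)\<^sup>2 + q * card M)"
    using sum_card_line_squared[OF assms(1)] by (rule of_nat_mono)
  then have s2: "(\<Sum>l\<in>L. (x l)\<^sup>2) \<le> m\<^sup>2 + q * m"
    by (simp add: x_def m_def)
  have "(\<Sum>l\<in>L. (x l - m / q)\<^sup>2) = (\<Sum>l\<in>L. (x l)\<^sup>2) - 2 * (m / q) * (\<Sum>l\<in>L. x l) + card L * (m / q)\<^sup>2"
    by (simp add: power2_diff sum.distrib sum_subtractf mult_ac flip: sum_distrib_left sum_distrib_right sum_divide_distrib)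
  also have "\<dots> = (\<Sum>l\<in>L. (x l)\<^sup>2) - m\<^sup>2"
    using assms(3) unfolding s1 card_L by (simp add: power2_eq_square field_simps)
  also have "\<dots> \<le> q * m" using s2 by simp
  finally have var: "(\<Sum>l\<in>L. (x l - m / q)\<^sup>2) \<le> q * m" .
  have "card poor * (m / (2 * q))\<^sup>2 \<le> (\<Sum>l\<in>poor. (x l - m / q)\<^sup>2)"
  proof (rule sum_bounded_below[of poor, unfolded of_nat_mult[symmetric]])
    fix l assume "l \<in> poor"
    then have "m / (2 * q) \<le> m / q - x l" unfolding poor_def using assms(3) by (simp add: field_simps)
    then have "(m / (2 * q))\<^sup>2 \<le> (m / q - x l)\<^sup>2" using m by (intro power_mono) auto
    then show "(m / (2 * q))\<^sup>2 \<le> (x l - m / q)\<^sup>2" by (simp add: power2_commute)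
  qed
  also have "\<dots> \<le> (\<Sum>l\<in>L. (x l - m / q)\<^sup>2)"
    using finite_L by (intro sum_mono2) (auto simp: poor_def)
  also note var
  finally have "card poor * m \<le> 4 * real q ^ 3"
    using m assms(3) by (simp add: power2_eq_square power3_eq_cube field_simps)
  moreover have "card poor * (8 * real q) \<le> card poor * m" using m by (intro mult_left_mono) auto
  ultimately have "card poor * (8 * real q) \<le> 4 * real q ^ 3" by linarith
  also have "\<dots> = (real q ^ 2 / 2) * (8 * real q)"
    by (simp add: power2_eq_square power3_eq_cube)
  finally have "card poor * (8 * real q) \<le> (real q ^ 2 / 2) * (8 * real q)" .
  then have "card poor \<le> real q ^ 2 / 2" using assms(3) by (subst (asm) mult_le_cancel_right) auto
  moreover have "L = poor \<union> {l \<in> L. m / (2 * q) \<le> x l}" by (auto simp: poor_def)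
  then have "card L \<le> card poor + card {l \<in> L. m / (2 * q) \<le> x l}" by (metis card_Un_le)
  then have "real q ^ 2 \<le> card poor + card {l \<in> L. m / (2 * q) \<le> x l}"
    unfolding card_L by (metis of_nat_add of_nat_le_iff of_nat_power)
  ultimately show ?thesis unfolding x_def m_def by simp
qed

text \<open>A line receives a number below \<open>P\<close>, and is kept if this number is \<open>0\<close>, together with a
  colouring of all points, of which only the colours of its own points matter.\<close>

definition choices :: "nat \<Rightarrow> nat \<Rightarrow> (nat \<times> ('v \<Rightarrow> nat)) set" where
  "choices P s = {..<P} \<times> (V \<rightarrow>\<^sub>E {..<s})"

definition outcomes :: "nat \<Rightarrow> nat \<Rightarrow> ('l \<Rightarrow> nat \<times> ('v \<Rightarrow> nat)) set" where
  "outcomes P s = L \<rightarrow>\<^sub>E choices P s"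

definition adj :: "('l \<Rightarrow> nat \<times> ('v \<Rightarrow> nat)) \<Rightarrow> 'v \<Rightarrow> 'v \<Rightarrow> bool" where
  "adj \<omega> u v \<longleftrightarrow> (\<exists>l\<in>L. on u l \<and> on v l \<and> fst (\<omega> l) = 0 \<and> snd (\<omega> l) u \<noteq> snd (\<omega> l) v)"

definition gr :: "('l \<Rightarrow> nat \<times> ('v \<Rightarrow> nat)) \<Rightarrow> 'v graph" where
  "gr \<omega> = (V, {{u, v} | u v. u \<in> V \<and> v \<in> V \<and> adj \<omega> u v})"

text \<open>The condition \<open>u \<noteq> w\<close> matters for \<open>lines_between T T\<close>,
  the lines spanned by \<open>T\<close>, where it excludes lines through a single point of
  \<open>T\<close>.\<close>

definition lines_between :: "'v set \<Rightarrow> 'v set \<Rightarrow> 'l set" where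
  "lines_between S R = {l \<in> L. \<exists>u\<in>S. \<exists>w\<in>R. u \<noteq> w \<and> on u l \<and> on w l}"

lemma adj_sym: "adj \<omega> u v \<longleftrightarrow> adj \<omega> v u"
  unfolding adj_def by metis

lemma adj_irrefl: "\<not> adj \<omega> u u"
  by (simp add: adj_def)

lemma simple_gr: "simple_graph (gr \<omega>)"
  using finite_V by (auto simp: simple_graph_def gr_def adj_irrefl)

lemma edge_gr_iff: "{u, v} \<in> edges (gr \<omega>) \<longleftrightarrow> u \<in> V \<and> v \<in> V \<and> adj \<omega> u v"
  using adj_sym by (auto simp: gr_def doubleton_eq_iff)

lemma finite_choices: "finite (choices P s)" "P > 0 \<Longrightarrow> s > 0 \<Longrightarrow> choices P s \<noteq> {}"
  using finite_V by (auto simp: choices_def PiE_eq_empty_iff intro!: finite_PiE)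

lemma finite_outcomes: "finite (outcomes P s)" "P > 0 \<Longrightarrow> s > 0 \<Longrightarrow> outcomes P s \<noteq> {}"
  using finite_L finite_choices unfolding outcomes_def
  by (auto simp: PiE_eq_empty_iff intro!: finite_PiE)

section \<open>Probabilities of the elementary events\<close>

lemma freq_choices:
  assumes "P > 0"
  shows "freq (choices P s) (\<lambda>a. fst a = 0 \<and> Q (snd a)) = freq (V \<rightarrow>\<^sub>E {..<s}) Q / P"
proof -
  have "{x \<in> {..<P}. x = 0} = {0}" using assms by auto
  then have "freq {..<P} (\<lambda>x. x = 0) = 1 / P" by (simp add: freq_def)
  then show ?thesis
    unfolding choices_def using finite_V
    by (subst freq_Times[of "{..<P}" _ "\<lambda>x. x = 0" Q]) (auto intro!: finite_PiE)
qed

lemma freq_colours_eq: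
  fixes s :: nat
  assumes "u \<in> V" "v \<in> V" "u \<noteq> v" "s > 0"
  shows "freq (V \<rightarrow>\<^sub>E {..<s}) (\<lambda>g. g u = g v) \<le> 1 / s"
proof -
  have fin: "finite (V \<rightarrow>\<^sub>E {..<s})" using finite_V by (simp add: finite_PiE)
  have "freq (V \<rightarrow>\<^sub>E {..<s}) (\<lambda>g. g u = g v)
      \<le> freq (V \<rightarrow>\<^sub>E {..<s}) (\<lambda>g. \<exists>c\<in>{..<s}. \<forall>i\<in>{u, v}. g i = c)"
    using assms by (intro freq_mono fin) auto
  also have "\<dots> \<le> real (card {..<s}) * (1 / s)\<^sup>2"
  proof (rule freq_Bex[OF fin])
    fix c assume "c \<in> {..<s}"
    then have "{x \<in> {..<s}. x = c} = {c}" by auto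
    then have "freq {..<s} (\<lambda>a. a = c) = 1 / s" by (simp add: freq_def)
    then show "freq (V \<rightarrow>\<^sub>E {..<s}) (\<lambda>g. \<forall>i\<in>{u, v}. g i = c) \<le> (1 / s)\<^sup>2"
      using assms finite_V freq_PiE[of V "{u, v}" "{..<s}" "\<lambda>i a. a = c"]
      by (simp add: power2_eq_square lessThan_empty_iff)
  qed simp
  finally show ?thesis using assms by (simp add: power2_eq_square)
qed

lemma freq_colour_missing:
  fixes s :: nat
  assumes "W \<subseteq> V" "s > 0"
  shows "freq (V \<rightarrow>\<^sub>E {..<s}) (\<lambda>g. \<exists>c\<in>{..<s}. \<forall>v\<in>W. g v \<noteq> c) \<le> s * (1 - 1 / s) ^ card W"
proof -
  have fin: "finite (V \<rightarrow>\<^sub>E {..<s})" using finite_V by (simp add: finite_PiE)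
  have "freq (V \<rightarrow>\<^sub>E {..<s}) (\<lambda>g. \<exists>c\<in>{..<s}. \<forall>v\<in>W. g v \<noteq> c)
      \<le> real (card {..<s}) * (1 - 1 / s) ^ card W"
  proof (rule freq_Bex[OF fin])
    fix c assume "c \<in> {..<s}"
    then have "{x \<in> {..<s}. x = c} = {c}" by auto
    then have "freq {..<s} (\<lambda>a. a = c) = 1 / s" by (simp add: freq_def)
    then have "freq {..<s} (\<lambda>a. a \<noteq> c) = 1 - 1 / s"
      using assms by (subst freq_not) (auto simp: lessThan_empty_iff)
    then show "freq (V \<rightarrow>\<^sub>E {..<s}) (\<lambda>g. \<forall>v\<in>W. g v \<noteq> c) \<le> (1 - 1 / s) ^ card W"
      using assms finite_V freq_PiE[of V W "{..<s}" "\<lambda>i a. a \<noteq> c"]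
      by (simp add: lessThan_empty_iff)
  qed simp
  then show ?thesis by simp
qed

lemma freq_kept:
  assumes "D \<subseteq> L" "P > 0" "s > 0"
  shows "freq (outcomes P s) (\<lambda>\<omega>. \<forall>l\<in>D. fst (\<omega> l) = 0) = (1 / P) ^ card D"
proof -
  have "freq (choices P s) (\<lambda>a. fst a = 0) = 1 / P"
    using freq_choices[OF assms(2), of s "\<lambda>_. True"] finite_V assms(3)
    by (simp add: freq_def card_PiE)
  then show ?thesis
    unfolding outcomes_def using assms finite_L finite_choices
    by (subst freq_PiE[where E = "\<lambda>_ a. fst a = 0"]) auto
qed

text \<open>The line \<open>l\<close> alone suffices: it is kept with probability
  \<open>1 / P\<close> and, as \<open>s \<ge> 2\<close>, separates \<open>u\<close> and
  \<open>v\<close> with probability at least \<open>1 / 2\<close>.\<close>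

lemma freq_adj:
  assumes "u \<in> V" "v \<in> V" "u \<noteq> v" "l \<in> L" "on u l" "on v l" "P > 0" "s \<ge> 2"
  shows "freq (outcomes P s) (\<lambda>\<omega>. adj \<omega> u v) \<ge> 1 / (2 * P)"
proof -
  have ne: "V \<rightarrow>\<^sub>E {..<s} \<noteq> {}" "finite (V \<rightarrow>\<^sub>E {..<s})"
    using assms(8) finite_V by (auto simp: PiE_eq_empty_iff lessThan_empty_iff intro!: finite_PiE)
  have "1 / real s \<le> 1 / 2" using assms(8) by (simp add: field_simps)
  then have "freq (V \<rightarrow>\<^sub>E {..<s}) (\<lambda>g. g u = g v) \<le> 1 / 2"
    using freq_colours_eq[OF assms(1-3), of s] assms(8) by linarith
  then have "1 / 2 \<le> freq (V \<rightarrow>\<^sub>E {..<s}) (\<lambda>g. g u \<noteq> g v)"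
    using freq_not[OF ne(2,1), of "\<lambda>g. g u = g v"] by simp
  then have "1 / (2 * P) \<le> freq (V \<rightarrow>\<^sub>E {..<s}) (\<lambda>g. g u \<noteq> g v) / P"
    using assms(7) by (simp add: field_simps)
  also have "\<dots> = freq (choices P s) (\<lambda>a. fst a = 0 \<and> snd a u \<noteq> snd a v)"
    by (rule freq_choices[OF assms(7), symmetric])
  also have "\<dots> = freq (outcomes P s) (\<lambda>\<omega>. \<forall>l\<in>{l}. fst (\<omega> l) = 0 \<and> snd (\<omega> l) u \<noteq> snd (\<omega> l) v)"
    unfolding outcomes_def using assms finite_L finite_choices
    by (subst freq_PiE[where E = "\<lambda>_ a. fst a = 0 \<and> snd a u \<noteq> snd a v"]) auto
  also have "\<dots> \<le> freq (outcomes P s) (\<lambda>\<omega>. adj \<omega> u v)"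
    using assms by (intro freq_mono finite_outcomes) (auto simp: adj_def)
  finally show ?thesis by simp
qed

section \<open>Rainbow lines, which supply copies of \<open>complete_graph s\<close> in large
  sets\<close>

definition rainbow_line :: "nat \<Rightarrow> ('l \<Rightarrow> nat \<times> ('v \<Rightarrow> nat)) \<Rightarrow> 'v set \<Rightarrow> bool" where
  "rainbow_line s \<omega> M \<longleftrightarrow>
     (\<exists>l\<in>L. fst (\<omega> l) = 0 \<and> (\<forall>c\<in>{..<s}. \<exists>v\<in>{v \<in> M. on v l}. snd (\<omega> l) v = c))"

text \<open>One point of each colour is taken on the kept line; their colours differ pairwise, so
  they are pairwise adjacent.\<close>

lemma rainbow_line_imp_copy:
  assumes "rainbow_line s \<omega> M" "M \<subseteq> V"
  shows "contains_copy (induced_subgraph (gr \<omega>) M) (complete_graph s)"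
proof -
  obtain l where l: "l \<in> L" "fst (\<omega> l) = 0"
    and c: "\<forall>c\<in>{..<s}. \<exists>v\<in>{v \<in> M. on v l}. snd (\<omega> l) v = c"
    using assms(1) unfolding rainbow_line_def by blast
  define f where "f c = (SOME v. v \<in> M \<and> on v l \<and> snd (\<omega> l) v = c)" for c
  have f: "f c \<in> M \<and> on (f c) l \<and> snd (\<omega> l) (f c) = c" if "c < s" for c
    unfolding f_def by (rule someI_ex) (use c that in fast)
  have "inj_on f {..<s}"
  proof (rule inj_onI)
    fix c d assume *: "c \<in> {..<s}" "d \<in> {..<s}" "f c = f d"
    then have "c < s" "d < s" by simp_all
    then have "snd (\<omega> l) (f c) = c" "snd (\<omega> l) (f d) = d" using f by blast+
    then show "c = d" unfolding *(3) by (rule trans[OF sym])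
  qed
  moreover have "f ` e \<in> edges (induced_subgraph (gr \<omega>) M)" if e_in: "e \<in> nsets {..<s} 2" for e
  proof -
    obtain c d where e: "e = {c, d}" "c < s" "d < s" "c \<noteq> d"
      using e_in by (auto simp: nsets_2_eq)
    have fc: "f c \<in> M" "on (f c) l" "snd (\<omega> l) (f c) = c"
      and fd: "f d \<in> M" "on (f d) l" "snd (\<omega> l) (f d) = d"
      using f[OF e(2)] f[OF e(3)] by blast+
    have "snd (\<omega> l) (f c) \<noteq> snd (\<omega> l) (f d)" unfolding fc(3) fd(3) by (rule e(4))
    then have "adj \<omega> (f c) (f d)" using l fc(2) fd(2) unfolding adj_def by blast
    then have "{f c, f d} \<in> edges (gr \<omega>)" using fc(1) fd(1) assms(2) edge_gr_iff by blast
    then show ?thesis using fc(1) fd(1) unfolding e(1) by (simp add: induced_subgraph_def)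
  qed
  moreover have "f ` {..<s} \<subseteq> M" using f by blast
  ultimately show ?thesis
    unfolding contains_copy_def complete_graph_def induced_subgraph_def
    by (intro exI[of _ f]) simp
qed

text \<open>By \<open>card_rich_lines\<close>, at least \<open>q\<^sup>2 / 2\<close> lines meet
  \<open>M\<close> in \<open>\<kappa>\<close> or more points. Such points miss a colour with
  probability at most \<open>1 / 2\<close>, so each of these lines independently succeeds with
  probability at least \<open>1 / (2 * P)\<close>.\<close>

lemma freq_no_rainbow_line:
  fixes s :: nat
  assumes "M \<subseteq> V" "8 * q \<le> card M" "q > 0" "P > 0" "s > 0"
    and "real \<kappa> \<le> card M / (2 * q)" "s * (1 - 1 / s) ^ \<kappa> \<le> 1 / 2"
  shows "freq (outcomes P s) (\<lambda>\<omega>. \<not> rainbow_line s \<omega> M) \<le> exp (- (real q ^ 2 / (4 * P)))"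
proof -
  define D where "D = {l \<in> L. real (card M) / (2 * q) \<le> card {v \<in> M. on v l}}"
  define E where "E l a \<longleftrightarrow> fst a = 0 \<and> (\<forall>c\<in>{..<s}. \<exists>v\<in>{v \<in> M. on v l}. snd a v = c)"
    for l and a :: "nat \<times> ('v \<Rightarrow> nat)"
  have ne: "V \<rightarrow>\<^sub>E {..<s} \<noteq> {}" "finite (V \<rightarrow>\<^sub>E {..<s})"
    using assms(5) finite_V by (auto simp: PiE_eq_empty_iff intro!: finite_PiE)
  have E: "freq (choices P s) (E l) \<ge> 1 / (2 * P)" if "l \<in> D" for l
  proof -
    let ?W = "{v \<in> M. on v l}"
    have "real \<kappa> \<le> real (card ?W)" using that assms(6) unfolding D_def by simp
    then have "\<kappa> \<le> card ?W" by simp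
    then have "(1 - 1 / real s) ^ card ?W \<le> (1 - 1 / real s) ^ \<kappa>"
      using assms(5) by (intro power_decreasing) auto
    then have "s * (1 - 1 / real s) ^ card ?W \<le> 1 / 2"
      using assms(7) mult_left_mono[of _ _ "real s"] by (meson of_nat_0_le_iff order_trans)
    then have "freq (V \<rightarrow>\<^sub>E {..<s}) (\<lambda>g. \<exists>c\<in>{..<s}. \<forall>v\<in>?W. g v \<noteq> c) \<le> 1 / 2"
      using freq_colour_missing[of ?W s] assms(1,5) by force
    then have "1 / 2 \<le> freq (V \<rightarrow>\<^sub>E {..<s}) (\<lambda>g. \<not> (\<exists>c\<in>{..<s}. \<forall>v\<in>?W. g v \<noteq> c))"
      using freq_not[OF ne(2,1), of "\<lambda>g. \<exists>c\<in>{..<s}. \<forall>v\<in>?W. g v \<noteq> c"] by linarith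
    then have "1 / 2 \<le> freq (V \<rightarrow>\<^sub>E {..<s}) (\<lambda>g. \<forall>c\<in>{..<s}. \<exists>v\<in>?W. g v = c)" by simp
    moreover have "freq (choices P s) (E l)
        = freq (V \<rightarrow>\<^sub>E {..<s}) (\<lambda>g. \<forall>c\<in>{..<s}. \<exists>v\<in>?W. g v = c) / P"
      unfolding E_def by (rule freq_choices[OF assms(4)])
    ultimately show ?thesis using assms(4) by (simp add: field_simps)
  qed
  have "freq (outcomes P s) (\<lambda>\<omega>. \<not> rainbow_line s \<omega> M)
      \<le> freq (outcomes P s) (\<lambda>\<omega>. \<forall>l\<in>D. \<not> E l (\<omega> l))"
    by (intro freq_mono finite_outcomes) (auto simp: rainbow_line_def E_def D_def)
  also have "\<dots> = (\<Prod>l\<in>D. freq (choices P s) (\<lambda>a. \<not> E l a))"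
    unfolding outcomes_def using assms finite_L finite_choices
    by (subst freq_PiE[where E = "\<lambda>l a. \<not> E l a"]) (auto simp: D_def)
  also have "\<dots> \<le> (\<Prod>l\<in>D. exp (- (1 / (2 * P))))"
  proof (intro prod_mono conjI freq_nonneg)
    fix l assume "l \<in> D"
    have "freq (choices P s) (\<lambda>a. \<not> E l a) \<le> 1 + - (1 / (2 * P))"
      using E[OF \<open>l \<in> D\<close>] freq_not[of "choices P s" "E l"] finite_choices assms(4,5) by simp
    also have "\<dots> \<le> exp (- (1 / (2 * P)))" by (rule exp_ge_add_one_self)
    finally show "freq (choices P s) (\<lambda>a. \<not> E l a) \<le> exp (- (1 / (2 * P)))" .
  qed
  also have "\<dots> = exp (- (card D / (2 * P)))"
    by (simp flip: exp_of_nat_mult)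
  also have "\<dots> \<le> exp (- (real q ^ 2 / (4 * P)))"
    using card_rich_lines[OF assms(1-3)] assms(4) by (simp add: D_def field_simps)
  finally show ?thesis by simp
qed

section \<open>Cliques and the lines they span\<close>

lemma copy_imp_clique:
  assumes "contains_copy (gr \<omega>) (complete_graph N)"
  shows "\<exists>T\<subseteq>V. card T = N \<and> (\<forall>u\<in>T. \<forall>v\<in>T. u \<noteq> v \<longrightarrow> adj \<omega> u v)"
proof -
  obtain f where f: "inj_on f {..<N}" "f ` {..<N} \<subseteq> V" "\<And>e. e \<in> nsets {..<N} 2 \<Longrightarrow> f ` e \<in> edges (gr \<omega>)"
    using assms by (auto simp: contains_copy_def complete_graph_def gr_def)
  have "adj \<omega> (f i) (f j)" if "i < N" "j < N" "f i \<noteq> f j" for i j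
  proof -
    have "{f i, f j} \<in> edges (gr \<omega>)" using f(3)[of "{i, j}"] that by auto
    then show ?thesis using edge_gr_iff by blast
  qed
  then show ?thesis using f by (intro exI[of _ "f ` {..<N}"]) (auto simp: card_image)
qed

text \<open>The first kind of unlikely configuration. Two points share at most one line, so
  \<open>k * r\<close> is the largest possible number of lines between \<open>S\<close> and
  \<open>R\<close>: all joining lines exist and are distinct.\<close>

definition fans :: "nat \<Rightarrow> nat \<Rightarrow> ('l \<times> 'v set \<times> 'v set) set" where
  "fans k r = {(l, S, R). l \<in> L \<and> S \<subseteq> {v \<in> V. on v l} \<and> card S = k \<and> R \<subseteq> V \<and> card R = r \<and>
     k * r \<le> card (lines_between S R)}"

text \<open>The second kind of unlikely configuration: \<open>N\<close> points spanning many
  lines.\<close>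

definition spread :: "nat \<Rightarrow> nat \<Rightarrow> 'v set set" where
  "spread N d = {T. T \<subseteq> V \<and> card T = N \<and> d \<le> card (lines_between T T)}"

text \<open>If a line contains many points of a clique, then all but few of them see any \<open>r\<close> points outside
  the line along distinct lines; otherwise the clique spans quadratically many lines.\<close>

lemma clique_cases:
  assumes \<omega>: "\<omega> \<in> outcomes P s"
    and T: "T \<subseteq> V" "card T = s + r" "\<And>u v. u \<in> T \<Longrightarrow> v \<in> T \<Longrightarrow> u \<noteq> v \<Longrightarrow> adj \<omega> u v"
    and k: "k > 0" and d: "d * (k + r * r)\<^sup>2 \<le> (s + r) * (s + r - 1)"
  shows "(\<exists>(l, S, R)\<in>fans k r. \<forall>l\<in>lines_between S R. fst (\<omega> l) = 0) \<or>
    (\<exists>T\<in>spread (s + r) d. \<forall>l\<in>lines_between T T. fst (\<omega> l) = 0)"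
proof -
  have finT: "finite T" using T(1) finite_V finite_subset by blast
  \<comment> \<open>The line behind an edge is the only line through its ends, so every line through
    two clique points is kept and separates their colours.\<close>
  have line: "fst (\<omega> l) = 0 \<and> snd (\<omega> l) u \<noteq> snd (\<omega> l) v"
    if "u \<in> T" "v \<in> T" "u \<noteq> v" "l \<in> L" "on u l" "on v l" for u v l
    using T(3)[OF that(1-3)] line_unique[of u v l] T(1) that unfolding adj_def by blast
  have kept: "fst (\<omega> l) = 0" if "l \<in> lines_between S R" "S \<subseteq> T" "R \<subseteq> T" for l S R
    using that line unfolding lines_between_def by blast
  show ?thesis
  proof (cases "\<exists>l\<in>L. k + r * r \<le> card {v \<in> T. on v l}")
    case True
    then obtain l where l: "l \<in> L" "k + r * r \<le> card {v \<in> T. on v l}" by blast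
    define Y where "Y = {v \<in> T. on v l}"
    \<comment> \<open>The clique points on \<open>l\<close> have distinct colours, so there are at
      most \<open>s\<close> of them and at least \<open>r\<close> clique points lie off
      \<open>l\<close>.\<close>
    have "snd (\<omega> l) ` Y \<subseteq> {..<s}"
      using \<omega> l(1) T(1) unfolding outcomes_def choices_def Y_def by (fastforce simp: PiE_iff)
    moreover have "inj_on (snd (\<omega> l)) Y" using line l(1) unfolding inj_on_def Y_def by blast
    ultimately have "card Y \<le> s" using card_inj_on_le[of "snd (\<omega> l)" Y "{..<s}"] by simp
    moreover have "card (T - Y) = card T - card Y"
      unfolding Y_def using finT by (intro card_Diff_subset) auto
    ultimately have "r \<le> card (T - Y)" using T(2) by simp
    then obtain R where R: "R \<subseteq> T - Y" "card R = r" "finite R"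
      by (metis obtain_subset_with_card_n)
    \<comment> \<open>\<open>X w\<close> holds the points of \<open>Y\<close> on the line through
      the two points of \<open>w\<close>. That line differs from \<open>l\<close> and meets it at
      most once, so discarding all these sets costs at most \<open>r * r\<close> points.\<close>
    define X where "X w = {u \<in> Y. fst w \<noteq> snd w \<and> (\<exists>l'\<in>L. on u l' \<and> on (fst w) l' \<and> on (snd w) l')}" for w
    have "card (X w) \<le> Suc 0" if "w \<in> R \<times> R" for w
    proof -
      have "u = u'" if u: "u \<in> X w" "u' \<in> X w" for u u'
      proof (rule ccontr)
        assume "u \<noteq> u'"
        obtain l' where l': "l' \<in> L" "on u l'" "on (fst w) l'" "on (snd w) l'"
          using u(1) unfolding X_def by blast
        obtain l'' where l'': "l'' \<in> L" "on u' l''" "on (fst w) l''" "on (snd w) l''"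
          using u(2) unfolding X_def by blast
        have w: "fst w \<in> T - Y" "snd w \<in> T - Y" "fst w \<noteq> snd w"
          using \<open>w \<in> R \<times> R\<close> R u unfolding X_def by auto
        then have "l'' = l'" using line_unique[of "fst w" "snd w" l'' l'] l' l'' T(1) by blast
        moreover have "u \<in> V" "u' \<in> V" "on u l" "on u' l" using u T(1) unfolding X_def Y_def by auto
        ultimately have "l' = l" using line_unique[of u u' l' l] \<open>u \<noteq> u'\<close> l' l'' l(1) by blast
        then show False using w l' unfolding Y_def by blast
      qed
      moreover have "finite (X w)" unfolding X_def Y_def using finT by auto
      ultimately show ?thesis by (subst card_le_Suc0_iff_eq) auto
    qed
    then have "card (\<Union>w\<in>R\<times>R. X w) \<le> (\<Sum>w\<in>R\<times>R. Suc 0)"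
      using R(3) by (intro order_trans[OF card_UN_le] sum_mono) auto
    then have "card (\<Union>w\<in>R\<times>R. X w) \<le> r * r" using R by (simp add: card_cartesian_product)
    moreover have "card Y - card (\<Union>w\<in>R\<times>R. X w) \<le> card (Y - (\<Union>w\<in>R\<times>R. X w))"
      using finT R(3) by (intro diff_card_le_card_Diff finite_UN_I) (auto simp: X_def Y_def)
    ultimately have "k \<le> card (Y - (\<Union>w\<in>R\<times>R. X w))" using l(2) unfolding Y_def by linarith
    then obtain S where S: "S \<subseteq> Y - (\<Union>w\<in>R\<times>R. X w)" "card S = k" "finite S"
      by (metis obtain_subset_with_card_n)
    have STR: "S \<subseteq> T" "R \<subseteq> T" using S R unfolding Y_def by auto
    have "\<exists>l'. l' \<in> L \<and> on (fst p) l' \<and> on (snd p) l'" if "p \<in> S \<times> R" for p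
      using T(3)[of "fst p" "snd p"] that S R unfolding adj_def Y_def by fastforce
    then obtain f where f: "\<And>p. p \<in> S \<times> R \<Longrightarrow> f p \<in> L \<and> on (fst p) (f p) \<and> on (snd p) (f p)"
      by metis
    \<comment> \<open>A repeated line would either contain two points of \<open>S\<close>, hence be
      \<open>l\<close>, which misses \<open>R\<close>, or contain two points of \<open>R\<close>,
      which puts its point of \<open>S\<close> into some \<open>X w\<close>.\<close>
    have "inj_on f (S \<times> R)"
    proof (rule inj_onI)
      fix p p' assume p: "p \<in> S \<times> R" "p' \<in> S \<times> R" "f p = f p'"
      have R': "fst p \<in> Y" "fst p' \<in> Y" "snd p \<in> T - Y" "snd p' \<in> T - Y" using p S R by auto
      have "fst p = fst p'"
      proof (rule ccontr)
        assume "fst p \<noteq> fst p'"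
        then have "f p = l"
          using line_unique[of "fst p" "fst p'" "f p" l] R' T(1) l(1) f[OF p(1)] f[OF p(2)] p(3)
          unfolding Y_def by auto
        then show False using f[OF p(1)] R' unfolding Y_def by auto
      qed
      moreover have "snd p = snd p'"
      proof (rule ccontr)
        assume "snd p \<noteq> snd p'"
        then have "fst p \<in> X (snd p, snd p')"
          using f[OF p(1)] f[OF p(2)] p(3) R' \<open>fst p = fst p'\<close> unfolding X_def by auto
        then show False using p S by auto
      qed
      ultimately show "p = p'" by (rule prod_eqI)
    qed
    moreover have "f ` (S \<times> R) \<subseteq> lines_between S R"
    proof safe
      fix u w assume uw: "u \<in> S" "w \<in> R"
      then have "u \<noteq> w" using S R by auto
      then show "f (u, w) \<in> lines_between S R"
        using f[of "(u, w)"] uw unfolding lines_between_def by auto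
    qed
    moreover have "finite (lines_between S R)" using finite_L unfolding lines_between_def by auto
    ultimately have "card (S \<times> R) \<le> card (lines_between S R)" by (intro card_inj_on_le)
    then have "(l, S, R) \<in> fans k r"
      using S R l(1) T(1) unfolding fans_def Y_def by (auto simp: card_cartesian_product)
    then show ?thesis using kept[OF _ STR] by (intro disjI1 bexI[of _ "(l, S, R)"]) auto
  next
    case False
    define D where "D = lines_between T T"
    have finD: "finite D" using finite_L unfolding D_def lines_between_def by auto
    \<comment> \<open>Each ordered pair of distinct clique points lies on a spanned line, and each
      line accounts for fewer than \<open>(k + r * r)\<^sup>2\<close> pairs.\<close>
    have "T \<times> T - Id_on T \<subseteq> (\<Union>l\<in>D. {v \<in> T. on v l} \<times> {v \<in> T. on v l})"
    proof (rule subsetI)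
      fix p assume "p \<in> T \<times> T - Id_on T"
      then obtain u v where p: "p = (u, v)" "u \<in> T" "v \<in> T" "u \<noteq> v" by auto
      then obtain l where "l \<in> L" "on u l" "on v l" using T(3)[of u v] unfolding adj_def by auto
      then show "p \<in> (\<Union>l\<in>D. {v \<in> T. on v l} \<times> {v \<in> T. on v l})"
        using p unfolding D_def lines_between_def by auto
    qed
    then have "card (T \<times> T - Id_on T) \<le> card (\<Union>l\<in>D. {v \<in> T. on v l} \<times> {v \<in> T. on v l})"
      using finT finD by (intro card_mono) auto
    also have "\<dots> \<le> (\<Sum>l\<in>D. card ({v \<in> T. on v l} \<times> {v \<in> T. on v l}))"
      using finD by (rule card_UN_le)
    also have "\<dots> \<le> (\<Sum>l\<in>D. (k + r * r)\<^sup>2)"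
      using False unfolding D_def lines_between_def card_cartesian_product power2_eq_square
      by (intro sum_mono mult_mono) auto
    finally have "card (T \<times> T - Id_on T) \<le> card D * (k + r * r)\<^sup>2" by simp
    moreover have "card (T \<times> T - Id_on T) = card (T \<times> T) - card (Id_on T)"
      using finT by (intro card_Diff_subset) (auto simp: Id_on_def)
    moreover have "card (Id_on T) = card T"
      by (rule bij_betw_same_card[of fst]) (force simp: bij_betw_def inj_on_def Id_on_def image_iff)
    ultimately have "(s + r) * (s + r) - (s + r) \<le> card D * (k + r * r)\<^sup>2"
      using T(2) by (simp add: card_cartesian_product)
    then have le: "(s + r) * (s + r - 1) \<le> card D * (k + r * r)\<^sup>2" by (simp add: diff_mult_distrib2)
    then have "d \<le> card D" using order_trans[OF d le] k by simp
    then have "T \<in> spread (s + r) d" using T unfolding spread_def D_def by auto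
    then show ?thesis using kept by (intro disjI2 bexI[of _ T]) auto
  qed
qed

end

section \<open>Union bound over the bad configurations\<close>

lemma card_subsets_le:
  assumes "finite A"
  shows "card {B. B \<subseteq> A \<and> card B = k} \<le> card A ^ k"
  using n_subsets[OF assms, of k] binomial_le_pow[of k "card A"]
  by (cases "k \<le> card A") (auto simp: binomial_eq_0)

context linear_space
begin

text \<open>Choosing \<open>l\<close> first confines \<open>S\<close> to at most \<open>K\<close>
  points, so \<open>S\<close> costs only \<open>K ^ k\<close> instead of
  \<open>card V ^ k\<close>.\<close>

lemma card_fans:
  assumes "\<And>l. l \<in> L \<Longrightarrow> card {v \<in> V. on v l} \<le> K"
  shows "card (fans k r) \<le> q\<^sup>2 * K ^ k * card V ^ r"
proof -
  let ?F = "SIGMA l:L. {S. S \<subseteq> {v \<in> V. on v l} \<and> card S = k} \<times> {R. R \<subseteq> V \<and> card R = r}"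
  have fin: "finite {S. S \<subseteq> {v \<in> V. on v l} \<and> card S = k}" "finite {R. R \<subseteq> V \<and> card R = r}" for l
    using finite_V by (auto intro: finite_subset[of _ "Pow V"])
  then have "card (fans k r) \<le> card ?F"
    using finite_L by (intro card_mono finite_SigmaI finite_cartesian_product) (auto simp: fans_def)
  also have "\<dots> = (\<Sum>l\<in>L. card {S. S \<subseteq> {v \<in> V. on v l} \<and> card S = k} * card {R. R \<subseteq> V \<and> card R = r})"
    using fin finite_L by (simp add: card_cartesian_product)
  also have "\<dots> \<le> (\<Sum>l\<in>L. K ^ k * card V ^ r)"
    using assms finite_V
    by (intro sum_mono mult_mono order_trans[OF card_subsets_le] power_mono) auto
  finally show ?thesis by (simp add: card_L)
qed

lemma finite_fans: "finite (fans k r)"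
proof (rule finite_subset)
  show "fans k r \<subseteq> L \<times> Pow V \<times> Pow V" by (auto simp: fans_def)
qed (use finite_L finite_V in auto)

lemma card_spread: "finite (spread N d)" "card (spread N d) \<le> card V ^ N"
proof -
  have "spread N d \<subseteq> {T. T \<subseteq> V \<and> card T = N}" by (auto simp: spread_def)
  moreover have "finite {T. T \<subseteq> V \<and> card T = N}"
    using finite_V by (auto intro: finite_subset[of _ "Pow V"])
  ultimately show "finite (spread N d)" "card (spread N d) \<le> card V ^ N"
    using card_subsets_le[OF finite_V, of N] by (auto intro: finite_subset order_trans[OF card_mono])
qed

lemma lines_between_subset: "lines_between S R \<subseteq> L"
  by (auto simp: lines_between_def)

text \<open>A rainbow line rules out each set of size at least \<open>m\<close>. As
  \<open>s > 0\<close>, the empty set is admissible, so the maximum is attained.\<close>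

lemma s_independence_number_gr_less:
  assumes "m > 0" "s > 0" "\<And>M. M \<subseteq> V \<Longrightarrow> m \<le> real (card M) \<Longrightarrow> rainbow_line s \<omega> M"
  shows "real (s_independence_number s (gr \<omega>)) < m"
proof -
  let ?A = "{card W | W. W \<subseteq> verts (gr \<omega>) \<and> \<not> contains_copy (induced_subgraph (gr \<omega>) W) (complete_graph s)}"
  have V: "verts (gr \<omega>) = V" by (simp add: gr_def)
  have "finite ?A" using finite_V by (auto simp: V)
  moreover have "\<not> contains_copy (induced_subgraph (gr \<omega>) {}) (complete_graph s)"
    using assms(2) by (auto simp: contains_copy_def complete_graph_def induced_subgraph_def lessThan_empty_iff)
  then have "?A \<noteq> {}" by blast
  ultimately have "Max ?A \<in> ?A" by (intro Max_in) auto
  then obtain W where W: "Max ?A = card W" "W \<subseteq> V"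
    "\<not> contains_copy (induced_subgraph (gr \<omega>) W) (complete_graph s)" unfolding V by blast
  then have "\<not> m \<le> real (card W)" using assms(3) rainbow_line_imp_copy by blast
  then show ?thesis unfolding s_independence_number_def W(1) by simp
qed

text \<open>The terms of \<open>small\<close> bound the probabilities of a kept fan, a kept spread
  set and a large set without rainbow line. Their sum stays below half of the edge probability
  \<open>1 / (2 * P)\<close>, as \<open>freq_average\<close> requires. Injectivity on
  \<open>X\<close> turns pairs into distinct edges.\<close>

lemma exists_ramsey_turan_graph:
  fixes s r k d P \<kappa> K :: nat and m :: real
  assumes "q > 0" "P > 0" "s \<ge> 2" "k > 0"
    and K: "\<And>l. l \<in> L \<Longrightarrow> card {v \<in> V. on v l} \<le> K"
    and m: "8 * real q \<le> m" "2 * real q * \<kappa> \<le> m" "s * (1 - 1 / s) ^ \<kappa> \<le> 1 / 2"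
    and d: "d * (k + r * r)\<^sup>2 \<le> (s + r) * (s + r - 1)"
    and X: "X \<subseteq> V \<times> V" "X \<noteq> {}" "inj_on (\<lambda>(u, v). {u, v}) X"
      "\<And>u v. (u, v) \<in> X \<Longrightarrow> u \<noteq> v \<and> (\<exists>l\<in>L. on u l \<and> on v l)"
    and small: "real q ^ 2 * real K ^ k * real (card V) ^ r * (1 / P) ^ (k * r)
      + real (card V) ^ (s + r) * (1 / P) ^ d + 2 ^ card V * exp (- (real q ^ 2 / (4 * P))) < 1 / (4 * P)"
  shows "\<exists>G. simple_graph G \<and> verts G = V \<and> \<not> contains_copy G (complete_graph (s + r)) \<and>
    real (s_independence_number s G) < m \<and> real (card X) / (4 * P) \<le> card (edges G)"
proof -
  let ?\<Omega> = "outcomes P s"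
  define B1 where "B1 \<omega> \<longleftrightarrow> (\<exists>x\<in>fans k r. \<forall>l\<in>lines_between (fst (snd x)) (snd (snd x)). fst (\<omega> l) = 0)"
    for \<omega> :: "'l \<Rightarrow> nat \<times> ('v \<Rightarrow> nat)"
  define B2 where "B2 \<omega> \<longleftrightarrow> (\<exists>T\<in>spread (s + r) d. \<forall>l\<in>lines_between T T. fst (\<omega> l) = 0)"
    for \<omega> :: "'l \<Rightarrow> nat \<times> ('v \<Rightarrow> nat)"
  define B3 where "B3 \<omega> \<longleftrightarrow> (\<exists>M\<in>{M. M \<subseteq> V \<and> m \<le> real (card M)}. \<not> rainbow_line s \<omega> M)"
    for \<omega> :: "'l \<Rightarrow> nat \<times> ('v \<Rightarrow> nat)"
  have \<Omega>: "finite ?\<Omega>" "?\<Omega> \<noteq> {}" using finite_outcomes assms(2,3) by auto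
  have P1: "0 \<le> 1 / real P" "1 / real P \<le> 1" using assms(2) by auto
  have "freq ?\<Omega> B1 \<le> card (fans k r) * (1 / P) ^ (k * r)"
    unfolding B1_def
  proof (rule freq_Bex[OF \<Omega>(1) finite_fans])
    fix x assume "x \<in> fans k r"
    then have "k * r \<le> card (lines_between (fst (snd x)) (snd (snd x)))" by (auto simp: fans_def)
    then show "freq ?\<Omega> (\<lambda>\<omega>. \<forall>l\<in>lines_between (fst (snd x)) (snd (snd x)). fst (\<omega> l) = 0) \<le> (1 / P) ^ (k * r)"
      using P1 assms(2,3) freq_kept[OF lines_between_subset] by (simp add: power_decreasing del: power_one_over)
  qed
  also have "\<dots> \<le> real (q\<^sup>2 * K ^ k * card V ^ r) * (1 / P) ^ (k * r)"
    using card_fans[OF K] by (intro mult_right_mono of_nat_mono) auto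
  finally have b1: "freq ?\<Omega> B1 \<le> real q ^ 2 * real K ^ k * real (card V) ^ r * (1 / P) ^ (k * r)" by simp
  have "freq ?\<Omega> B2 \<le> card (spread (s + r) d) * (1 / P) ^ d"
    unfolding B2_def
  proof (rule freq_Bex[OF \<Omega>(1) card_spread(1)])
    fix T assume "T \<in> spread (s + r) d"
    then have "d \<le> card (lines_between T T)" by (auto simp: spread_def)
    then show "freq ?\<Omega> (\<lambda>\<omega>. \<forall>l\<in>lines_between T T. fst (\<omega> l) = 0) \<le> (1 / P) ^ d"
      using P1 assms(2,3) freq_kept[OF lines_between_subset] by (simp add: power_decreasing del: power_one_over)
  qed
  also have "\<dots> \<le> real (card V ^ (s + r)) * (1 / P) ^ d"
    using card_spread(2) by (intro mult_right_mono of_nat_mono) auto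
  finally have b2: "freq ?\<Omega> B2 \<le> real (card V) ^ (s + r) * (1 / P) ^ d" by simp
  have "freq ?\<Omega> B3 \<le> card {M. M \<subseteq> V \<and> m \<le> real (card M)} * exp (- (real q ^ 2 / (4 * P)))"
    unfolding B3_def
  proof (rule freq_Bex[OF \<Omega>(1)])
    show "finite {M. M \<subseteq> V \<and> m \<le> real (card M)}"
      using finite_V by (auto intro: finite_subset[of _ "Pow V"])
    fix M assume "M \<in> {M. M \<subseteq> V \<and> m \<le> real (card M)}"
    then have M: "M \<subseteq> V" "m \<le> real (card M)" by auto
    then have "8 * real q \<le> real (card M)" using m(1) by linarith
    then have "8 * q \<le> card M" by linarith
    moreover have "real \<kappa> \<le> card M / (2 * q)" using M m(2) assms(1) by (simp add: field_simps)
    ultimately show "freq ?\<Omega> (\<lambda>\<omega>. \<not> rainbow_line s \<omega> M) \<le> exp (- (real q ^ 2 / (4 * P)))"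
      using freq_no_rainbow_line[of M P s \<kappa>] M(1) assms(1-3) m(3) by simp
  qed
  also have "\<dots> \<le> 2 ^ card V * exp (- (real q ^ 2 / (4 * P)))"
  proof (rule mult_right_mono)
    have "card {M. M \<subseteq> V \<and> m \<le> real (card M)} \<le> card (Pow V)"
      using finite_V by (intro card_mono) auto
    then show "real (card {M. M \<subseteq> V \<and> m \<le> real (card M)}) \<le> 2 ^ card V"
      using finite_V by (simp add: card_Pow)
  qed simp
  finally have b3: "freq ?\<Omega> B3 \<le> 2 ^ card V * exp (- (real q ^ 2 / (4 * P)))" .
  have "freq ?\<Omega> (\<lambda>\<omega>. B1 \<omega> \<or> B2 \<omega> \<or> B3 \<omega>) \<le> freq ?\<Omega> B1 + (freq ?\<Omega> B2 + freq ?\<Omega> B3)"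
    by (intro order_trans[OF freq_disj[OF \<Omega>(1)]] add_left_mono freq_disj[OF \<Omega>(1)])
  also have "\<dots> < 1 / (4 * P)" using b1 b2 b3 small by linarith
  finally have bad: "freq ?\<Omega> (\<lambda>\<omega>. B1 \<omega> \<or> B2 \<omega> \<or> B3 \<omega>) < (1 / (2 * P)) / 2" by simp
  have "finite X" using X(1) finite_V by (meson finite_SigmaI finite_subset)
  moreover have "freq ?\<Omega> (\<lambda>\<omega>. case e of (u, v) \<Rightarrow> adj \<omega> u v) \<ge> 1 / (2 * P)" if "e \<in> X" for e
  proof -
    obtain u v where e: "e = (u, v)" by (cases e)
    then have uv: "(u, v) \<in> X" using that by simp
    then obtain l where "l \<in> L" "on u l" "on v l" "u \<noteq> v" "u \<in> V" "v \<in> V" using X(1,4) by blast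
    then show ?thesis using freq_adj[of u v l P s] assms(2,3) e by simp
  qed
  ultimately obtain \<omega> where \<omega>: "\<omega> \<in> ?\<Omega>" "\<not> B1 \<omega>" "\<not> B2 \<omega>" "\<not> B3 \<omega>"
    and e: "1 / (2 * P) * card X / 2 \<le> card {e \<in> X. case e of (u, v) \<Rightarrow> adj \<omega> u v}"
    using freq_average[OF \<Omega> _ X(2), of "1 / (2 * P)" "\<lambda>e \<omega>. case e of (u, v) \<Rightarrow> adj \<omega> u v", OF _ _ _ bad]
      assms(2) by auto
  have "\<not> contains_copy (gr \<omega>) (complete_graph (s + r))"
  proof
    assume "contains_copy (gr \<omega>) (complete_graph (s + r))"
    from copy_imp_clique[OF this] obtain T
      where T: "T \<subseteq> V" "card T = s + r" "\<forall>u\<in>T. \<forall>v\<in>T. u \<noteq> v \<longrightarrow> adj \<omega> u v" by blast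
    have "B1 \<omega> \<or> B2 \<omega>"
      using clique_cases[OF \<omega>(1) T(1,2) T(3)[rule_format] assms(4) d] unfolding B1_def B2_def case_prod_unfold .
    then show False using \<omega>(2,3) by blast
  qed
  moreover have "real (s_independence_number s (gr \<omega>)) < m"
    using \<omega>(4) assms(1,3) m(1) unfolding B3_def by (intro s_independence_number_gr_less) auto
  moreover have "card X / (4 * P) \<le> card (edges (gr \<omega>))"
  proof -
    have "(\<lambda>(u, v). {u, v}) ` {e \<in> X. case e of (u, v) \<Rightarrow> adj \<omega> u v} \<subseteq> edges (gr \<omega>)"
      using X(1) edge_gr_iff by auto
    moreover have "finite (edges (gr \<omega>))"
      using simple_gr[of \<omega>] finite_imp_finite_nsets finite_subset unfolding simple_graph_def by blast
    moreover have "inj_on (\<lambda>(u, v). {u, v}) {e \<in> X. case e of (u, v) \<Rightarrow> adj \<omega> u v}"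
      using X(3) by (rule inj_on_subset) auto
    ultimately have "card {e \<in> X. case e of (u, v) \<Rightarrow> adj \<omega> u v} \<le> card (edges (gr \<omega>))"
      by (intro card_inj_on_le)
    then show ?thesis using e by simp
  qed
  ultimately show ?thesis using simple_gr[of \<omega>] by (intro exI[of _ "gr \<omega>"]) (auto simp: gr_def)
qed

end

section \<open>The affine plane\<close>

text \<open>The number \<open>v < q * q\<close> stands for the point \<open>(v div q, v mod q)\<close> of the affine plane over the
  field with \<open>q\<close> elements, and \<open>(a, b)\<close> for the line of slope \<open>a\<close> and intercept \<open>b\<close>.
  The vertical lines are left out.\<close>

definition on_line :: "nat \<Rightarrow> nat \<Rightarrow> nat \<times> nat \<Rightarrow> bool" where
  "on_line q v l \<longleftrightarrow> v mod q = (fst l * (v div q) + snd l) mod q"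

text \<open>The ordinate \<open>v mod q\<close> is congruent to \<open>v\<close>, so incidence
  becomes a linear congruence in integers.\<close>

lemma on_line_iff_dvd: "on_line q v (a, b) \<longleftrightarrow> int q dvd int a * int (v div q) + int b - int v"
proof -
  have "on_line q v (a, b) \<longleftrightarrow> int (a * (v div q) + b) mod int q = int v mod int q"
    unfolding on_line_def by (metis fst_conv snd_conv of_nat_eq_iff of_nat_mod)
  then show ?thesis by (simp add: mod_eq_dvd_iff)
qed

lemma eq_if_dvd_diff:
  assumes "int q dvd int a - int b" "a < q" "b < q"
  shows "a = b"
  using assms by (metis mod_eq_dvd_iff mod_less nat_int of_nat_mod)

text \<open>Subtracting the equations leaves \<open>(a - a') * (x - y)\<close> divisible by
  \<open>q\<close>. The columns \<open>x\<close> and \<open>y\<close> differ, since a line has at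
  most one point in each column.\<close>

lemma on_line_unique:
  assumes "prime q" "u < q * q" "v < q * q" "u \<noteq> v" "l \<in> {..<q} \<times> {..<q}" "l' \<in> {..<q} \<times> {..<q}"
    and "on_line q u l" "on_line q v l" "on_line q u l'" "on_line q v l'"
  shows "l = l'"
proof -
  obtain a b a' b' where l: "l = (a, b)" "l' = (a', b')" by (metis surj_pair)
  have lt: "a < q" "b < q" "a' < q" "b' < q" using assms l by auto
  define x y where "x = int (u div q)" and "y = int (v div q)"
  have on: "int q dvd int a * x + int b - int u" "int q dvd int a * y + int b - int v"
    "int q dvd int a' * x + int b' - int u" "int q dvd int a' * y + int b' - int v"
    using assms(7-10) unfolding l on_line_iff_dvd x_def y_def by auto
  have ne: "u div q \<noteq> v div q"
  proof
    assume eq: "u div q = v div q"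
    then have "u mod q = v mod q" using assms(7,8) unfolding on_line_def by simp
    then show False using eq assms(4) by (metis div_mult_mod_eq)
  qed
  have "(int a * x + int b - int u) - (int a * y + int b - int v)
      - ((int a' * x + int b' - int u) - (int a' * y + int b' - int v)) = (int a - int a') * (x - y)"
    by (simp add: algebra_simps)
  then have "int q dvd (int a - int a') * (x - y)" using on by (metis dvd_diff)
  moreover have "\<not> int q dvd x - y"
    using ne eq_if_dvd_diff[of q "u div q" "v div q"] assms(2,3) unfolding x_def y_def
    by (auto simp: less_mult_imp_div_less)
  ultimately have "int q dvd int a - int a'"
    using assms(1) by (metis prime_dvd_mult_iff prime_nat_int_transfer)
  then have a: "a = a'" using lt by (intro eq_if_dvd_diff)
  have "(int a * x + int b - int u) - (int a' * x + int b' - int u) = int b - int b'" by (simp add: a)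
  then have "int q dvd int b - int b'" using on by (metis dvd_diff)
  then have "b = b'" using lt by (intro eq_if_dvd_diff)
  then show ?thesis using a l by simp
qed

text \<open>Modulo the prime \<open>q\<close> the difference of the columns has an inverse
  \<open>z\<close>, which gives the slope; the intercept then follows from \<open>u\<close>.\<close>

lemma on_line_exists:
  assumes "prime q" "u < q * q" "v < q * q" "u div q \<noteq> v div q"
  shows "\<exists>l\<in>{..<q} \<times> {..<q}. on_line q u l \<and> on_line q v l"
proof -
  define x y where "x = int (u div q)" and "y = int (v div q)"
  have q: "q > 0" using assms(1) by (rule prime_gt_0_nat)
  have "\<not> int q dvd x - y"
    using assms(4) eq_if_dvd_diff[of q "u div q" "v div q"] assms(2,3) unfolding x_def y_def
    by (auto simp: less_mult_imp_div_less)
  then have "coprime (x - y) (int q)"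
    using assms(1) by (metis coprime_commute prime_imp_coprime prime_nat_int_transfer)
  then obtain z where "[(x - y) * z = 1] (mod int q)" using cong_solve_coprime_int by blast
  then obtain t where t: "(x - y) * z - 1 = int q * t" by (metis cong_iff_dvd_diff dvdE)
  define a where "a = nat ((z * (int u - int v)) mod int q)"
  define b where "b = nat ((int u - int a * x) mod int q)"
  have "int a = (z * (int u - int v)) mod int q" "int b = (int u - int a * x) mod int q"
    using q unfolding a_def b_def by auto
  then obtain i j where a: "int a = z * (int u - int v) - int q * i" and b: "int b = int u - int a * x - int q * j"
    by (metis minus_mult_div_eq_mod)
  have lt: "a < q" "b < q" using q unfolding a_def b_def by (auto simp: nat_less_iff)
  have "int a * x + int b - int u = int q * (- j)" by (simp add: b)
  then have "on_line q u (a, b)" unfolding on_line_iff_dvd x_def by (metis dvd_triv_left)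
  moreover have "int a * y + int b - int v = int q * (i * (x - y) - j - t * (int u - int v))"
  proof -
    have "int a * y + int b - int v = (int u - int v) * (1 - (x - y) * z) + int q * (i * (x - y) - j)"
      unfolding b unfolding a by (simp add: algebra_simps)
    also have "1 - (x - y) * z = - (int q * t)" using t by simp
    finally show ?thesis by (simp add: algebra_simps)
  qed
  then have "on_line q v (a, b)" unfolding on_line_iff_dvd y_def by (metis dvd_triv_left)
  ultimately show ?thesis using lt by (intro bexI[of _ "(a, b)"]) auto
qed

text \<open>Each slope \<open>a\<close> admits exactly one intercept \<open>f a\<close>.\<close>

lemma card_lines_through_point:
  assumes "q > 0"
  shows "card {l \<in> {..<q} \<times> {..<q}. on_line q v l} = q"
proof -
  define f where "f a = nat ((int v - int a * int (v div q)) mod int q)" for a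
  have f: "int (f a) = (int v - int a * int (v div q)) mod int q" "f a < q" for a
    using assms unfolding f_def by (auto simp: nat_less_iff)
  have "on_line q v (a, b) \<longleftrightarrow> b = f a" if "b < q" for a b
  proof -
    have "on_line q v (a, b) \<longleftrightarrow> int q dvd int b - (int v - int a * int (v div q))"
      unfolding on_line_iff_dvd by (simp add: algebra_simps)
    also have "\<dots> \<longleftrightarrow> int b mod int q = (int v - int a * int (v div q)) mod int q"
      by (simp add: mod_eq_dvd_iff)
    also have "\<dots> \<longleftrightarrow> b = f a" using that by (simp flip: f(1))
    finally show ?thesis .
  qed
  then have "{l \<in> {..<q} \<times> {..<q}. on_line q v l} = (\<lambda>a. (a, f a)) ` {..<q}"
    using f(2) by auto
  then show ?thesis by (simp add: card_image inj_on_def)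
qed

lemma linear_space_on_line:
  assumes "prime q" "n \<le> q * q"
  shows "linear_space {..<n} ({..<q} \<times> {..<q}) (on_line q) q"
proof
  fix u v l l'
  assume "u \<in> {..<n}" "v \<in> {..<n}" "u \<noteq> v" "l \<in> {..<q} \<times> {..<q}" "l' \<in> {..<q} \<times> {..<q}"
    "on_line q u l" "on_line q v l" "on_line q u l'" "on_line q v l'"
  then show "l = l'" using assms by (intro on_line_unique[of q u v]) auto
next
  fix v show "card {l \<in> {..<q} \<times> {..<q}. on_line q v l} = q"
    using card_lines_through_point prime_gt_0_nat[OF assms(1)] .
qed (auto simp: power2_eq_square)

text \<open>A line has at most one point in each column, and the points lie in the first
  \<open>K\<close> columns.\<close>

lemma card_points_on_line:
  assumes "q > 0" "n \<le> K * q"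
  shows "card {v \<in> {..<n}. on_line q v l} \<le> K"
proof -
  have "inj_on (\<lambda>v. v div q) {v \<in> {..<n}. on_line q v l}"
  proof (rule inj_onI)
    fix u v assume *: "u \<in> {v \<in> {..<n}. on_line q v l}" "v \<in> {v \<in> {..<n}. on_line q v l}" "u div q = v div q"
    then have "u mod q = v mod q" unfolding on_line_def by simp
    then show "u = v" using *(3) by (metis div_mult_mod_eq)
  qed
  moreover have "(\<lambda>v. v div q) ` {v \<in> {..<n}. on_line q v l} \<subseteq> {..<K}"
    using assms by (auto intro!: less_mult_imp_div_less)
  ultimately show ?thesis using card_inj_on_le[of _ _ "{..<K}"] by fastforce
qed

section \<open>Lower bounds for \<open>RT\<close> from the affine plane\<close>

lemma RT_ge:
  assumes "simple_graph G" "verts G = {..<n}" "\<not> contains_copy G H" "real (s_independence_number s G) < f n"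
  shows "card (edges G) \<le> RT s n H f"
proof -
  have G: "G \<in> RT_graphs s n H f" using assms by (simp add: RT_graphs_def)
  have "RT_graphs s n H f \<subseteq> {{..<n}} \<times> Pow (nsets {..<n} 2)"
    by (auto simp: RT_graphs_def simple_graph_def)
  then have "finite (RT_graphs s n H f)"
    by (rule finite_subset) (simp add: finite_imp_finite_nsets)
  then show ?thesis using G by (auto simp: RT_def intro!: Max_ge)
qed

lemma RT_ge_plane:
  fixes s r k d P \<kappa> K q n :: nat
  assumes "prime q" "n \<le> q * q" "n \<le> K * q" "4 * q \<le> n" "n \<ge> 4" "P > 0" "s \<ge> 2" "k > 0"
    and m: "8 * real q \<le> f n" "2 * real q * \<kappa> \<le> f n" "s * (1 - 1 / s) ^ \<kappa> \<le> 1 / 2"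
    and d: "d * (k + r * r)\<^sup>2 \<le> (s + r) * (s + r - 1)"
    and small: "real q ^ 2 * real K ^ k * real n ^ r * (1 / P) ^ (k * r)
      + real n ^ (s + r) * (1 / P) ^ d + 2 ^ n * exp (- (real q ^ 2 / (4 * P))) < 1 / (4 * P)"
  shows "real n ^ 2 / (64 * P) \<le> real (RT s n (complete_graph (s + r)) f)"
proof -
  interpret linear_space "{..<n}" "{..<q} \<times> {..<q}" "on_line q" q
    using assms(1,2) by (rule linear_space_on_line)
  have q: "q > 0" using assms(1) by (rule prime_gt_0_nat)
  define h where "h = n div 4"
  \<comment> \<open>the gap of size \<open>q\<close> puts the two points of each pair on different vertical lines\<close>
  define X where "X = {..<h} \<times> {h + q..<n}"
  have X: "u < n \<and> v < n \<and> u \<noteq> v \<and> u < v \<and> (\<exists>l\<in>{..<q} \<times> {..<q}. on_line q u l \<and> on_line q v l)"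
    if "(u, v) \<in> X" for u v
  proof -
    have uv: "u < h" "h + q \<le> v" "v < n" using that by (auto simp: X_def)
    then have "(u + q) div q \<le> v div q" by (intro div_le_mono) auto
    then have "u div q \<noteq> v div q" using q by simp
    then show ?thesis using uv assms(1,2) on_line_exists[of q u v] by auto
  qed
  have "4 * h \<le> n" "n < 4 * h + 4" unfolding h_def by simp_all
  moreover have "h > 0" using assms(5) unfolding h_def by (simp add: div_greater_zero_iff)
  \<comment> \<open>Hence \<open>X\<close> has at least \<open>n / 8\<close> times
    \<open>n / 2\<close> pairs, which with the factor \<open>4 * P\<close> gives the constant
    \<open>64\<close>.\<close>
  ultimately have h: "h > 0" "h + q < n" "n \<le> 8 * h" "n \<le> 2 * (n - (h + q))"
    using assms(4) q by linarith+
  have "\<exists>G. simple_graph G \<and> verts G = {..<n} \<and> \<not> contains_copy G (complete_graph (s + r)) \<and>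
      real (s_independence_number s G) < f n \<and> real (card X) / (4 * P) \<le> card (edges G)"
  proof (rule exists_ramsey_turan_graph[OF q assms(6-8) _ m d])
    show "X \<subseteq> {..<n} \<times> {..<n}" using X by force
    show "X \<noteq> {}" using h by (auto simp: X_def lessThan_empty_iff)
    show "inj_on (\<lambda>(u, v). {u, v}) X"
    proof (rule inj_onI, clarify)
      fix u v u' v' assume *: "(u, v) \<in> X" "(u', v') \<in> X" "{u, v} = {u', v'}"
      then have "u < v" "u' < v'" using X by blast+
      then show "u = u' \<and> v = v'" using *(3) by (auto simp: doubleton_eq_iff)
    qed
  qed (use small X card_points_on_line[OF q assms(3)] in auto)
  then obtain G where G: "simple_graph G" "verts G = {..<n}" "\<not> contains_copy G (complete_graph (s + r))"
      "real (s_independence_number s G) < f n" "real (card X) / (4 * P) \<le> card (edges G)" by blast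
  have "n * n \<le> (8 * h) * (2 * (n - (h + q)))" using h by (intro mult_mono) auto
  then have "n * n \<le> 16 * card X" by (simp add: X_def card_cartesian_product)
  then have "real n ^ 2 \<le> 16 * card X" unfolding power2_eq_square by (metis of_nat_le_iff of_nat_mult of_nat_numeral)
  then have "real n ^ 2 / (64 * P) \<le> real (card X) / (4 * P)" using assms(6) by (simp add: field_simps)
  also have "\<dots> \<le> card (edges G)" by (rule G)
  also have "\<dots> \<le> real (RT s n (complete_graph (s + r)) f)" using RT_ge[of G n] G by simp
  finally show ?thesis .
qed

section \<open>Asymptotics\<close>

lemma eventually_mult_powr_less:
  fixes c d C :: real
  assumes "c < d"
  shows "\<forall>\<^sub>F n in sequentially. C * real n powr c < real n powr d"
proof -
  have "filterlim (\<lambda>n. real n powr (d - c)) at_top sequentially"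
    using assms by real_asymp
  then have "\<forall>\<^sub>F n in sequentially. C < real n powr (d - c)"
    by (simp add: filterlim_at_top_dense)
  with eventually_gt_at_top[of "0::nat"] show ?thesis
  proof eventually_elim
    case (elim n)
    then have "C * real n powr c < real n powr (d - c) * real n powr c"
      by (intro mult_strict_right_mono) auto
    also have "\<dots> = real n powr d" by (simp flip: powr_add)
    finally show ?case .
  qed
qed

lemma exists_power_less:
  fixes s :: nat
  assumes "s \<ge> 2"
  shows "\<exists>\<kappa>. s * (1 - 1 / s) ^ \<kappa> \<le> 1 / 2"
proof -
  have "\<exists>\<kappa>. (1 - 1 / real s) ^ \<kappa> < 1 / (2 * s)"
    using assms by (intro real_arch_pow_inv) auto
  then obtain \<kappa> where "(1 - 1 / real s) ^ \<kappa> < 1 / (2 * s)" ..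
  then have "s * (1 - 1 / real s) ^ \<kappa> \<le> s * (1 / (2 * s))"
    using assms by (intro mult_left_mono) auto
  then show ?thesis using assms by (intro exI[of _ \<kappa>]) simp
qed

text \<open>The constants, all independent of \<open>n\<close>. Lines are kept with probability
  about \<open>n powr (- a)\<close>; \<open>k\<close> makes fans unlikely, \<open>d\<close> makes
  spread sets unlikely, and \<open>e\<close> is the slack in the exponents.\<close>

context
  fixes r s k d \<kappa> :: nat and \<delta> e a :: real
  assumes r: "r \<ge> 1" and s: "s \<ge> 2" and e: "e > 0"
    and a: "a = (1 - \<delta>) / r + e" "2 * \<delta> - a - e > 1" and \<delta>: "\<delta> < 1"
    and k: "k * (e / 2) > 2 + r + a" "k > 0"
    and \<kappa>: "s * (1 - 1 / s) ^ \<kappa> \<le> 1 / 2"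
    and d: "d * (k + r * r)\<^sup>2 \<le> (s + r) * (s + r - 1)" "a * d > s + r + a"
begin

text \<open>Each of the three terms of \<open>small\<close> is eventually below
  \<open>n powr (- a) / 24\<close>. As \<open>P\<close> is at most \<open>2 * n powr a\<close>,
  their sum is below \<open>1 / (4 * P)\<close>.\<close>

lemma eventually_RT_ge:
  "\<forall>\<^sub>F n in sequentially. real n powr (2 - a) / 128
     \<le> real (RT s n (complete_graph (s + r)) (\<lambda>m. real m powr \<delta>))"
proof -
  \<comment> \<open>Exponents enclosing the prime \<open>q\<close>: \<open>u\<close> is large enough
    for \<open>2 * u - a > 1\<close>, and \<open>v < \<delta>\<close> leaves room for the constant
    factors \<open>8\<close> and \<open>2 * \<kappa>\<close>.\<close>
  define u v where "u = \<delta> - e / 2" and "v = \<delta> - e / 4"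
  have a0: "a > 0" using r \<delta> e unfolding a by (intro add_nonneg_pos) auto
  have u: "2 * u - a > 1" "0 < u" "u < v" "v < \<delta>"
    using a(2) a0 e by (simp_all add: u_def v_def field_simps)
  have ra: "r * a = 1 - \<delta> + r * e" unfolding a using r by (simp add: field_simps)
  have "\<forall>\<^sub>F n in sequentially. (24 * 2 ^ k) * real n powr (2 + r + k * (1 - u) - a * (k * r)) < real n powr (- a)"
  proof (rule eventually_mult_powr_less)
    \<comment> \<open>Each point of \<open>S\<close> costs a factor \<open>n powr (1 - u)\<close>,
      while its \<open>r\<close> kept lines gain \<open>n powr (r * a)\<close>. The net gain is at
      least \<open>n powr (e / 2)\<close>, and \<open>k\<close> is chosen to make it outweigh
      \<open>2 + r + a\<close>.\<close>
    have "real k * (r * a - (1 - u)) = real k * (r * e - e / 2)" unfolding ra u_def by simp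
    also have "\<dots> \<ge> real k * (e / 2)" using r e by (intro mult_left_mono) auto
    finally show "2 + r + k * (1 - u) - a * (k * r) < - a" using k(1) by (simp add: algebra_simps)
  qed
  moreover have "\<forall>\<^sub>F n in sequentially. 24 * real n powr (real (s + r) - a * d) < real n powr (- a)"
    using d by (intro eventually_mult_powr_less) auto
  moreover have "\<forall>\<^sub>F x::real in at_top. 2 powr x * exp (- (x powr (2 * u - a) / 8)) < x powr (- a) / 24"
    using u(1) a0 by real_asymp
  then have "\<forall>\<^sub>F n in sequentially. 2 powr real n * exp (- (real n powr (2 * u - a) / 8)) < real n powr (- a) / 24"
    by (rule eventually_nat_real)
  moreover have "\<forall>\<^sub>F n in sequentially. 8 * real n powr v < real n powr \<delta>"
    "\<forall>\<^sub>F n in sequentially. (2 * real \<kappa>) * real n powr v < real n powr \<delta>"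
    using u by (intro eventually_mult_powr_less; simp)+
  moreover have "\<forall>\<^sub>F n in sequentially. 4 * real n powr v < real n powr 1"
    using u \<delta> by (intro eventually_mult_powr_less) simp
  ultimately show ?thesis
    using eventually_prime_between_powr[OF u(2,3)] eventually_ge_at_top[of 4]
  proof eventually_elim
    case (elim n)
    then obtain q where q: "prime q" "real n powr u \<le> real q" "real q \<le> real n powr v" by blast
    have n: "real n \<ge> 1" using elim by simp
    have q0: "q > 0" using q(1) by (rule prime_gt_0_nat)
    define P where "P = nat \<lceil>real n powr a\<rceil>"
    have na: "real n powr a \<ge> 1" using n a0 by (simp add: ge_one_powr_ge_zero)
    then have P: "real n powr a \<le> real P" "real P \<le> 2 * real n powr a" "P > 0"
      unfolding P_def by linarith+
    \<comment> \<open>An upper bound for the number of columns that \<open>{..<n}\<close> meets; the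
      added \<open>1\<close> covers an incomplete last column.\<close>
    define K where "K = n div q + 1"
    have "real n powr (1 - u) \<ge> 1" using n u \<delta> by (intro ge_one_powr_ge_zero) auto
    moreover have "real n / real q \<le> real n powr (1 - u)"
    proof -
      have "real n / real q \<le> real n / real n powr u" using q q0 n by (intro divide_left_mono) auto
      then show ?thesis using n by (simp add: powr_diff)
    qed
    moreover have "real K \<le> real n / real q + 1"
      unfolding K_def by (simp add: of_nat_div_le_of_nat)
    ultimately have K: "real K \<le> 2 * real n powr (1 - u)" by linarith
    have nK: "n \<le> K * q" unfolding K_def
      using q0 by (metis Suc_eq_plus1 dividend_less_div_times less_imp_le mult.commute mult_Suc add.commute)
    have "real n powr 1 \<le> real n powr (2 * u)" using n u a0 by (intro powr_mono) auto
    also have "\<dots> = real n powr u * real n powr u" by (simp flip: powr_add)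
    also have "\<dots> \<le> real q * real q" using q by (intro mult_mono) auto
    finally have "real n \<le> real (q * q)" using n by simp
    then have nq: "n \<le> q * q" by linarith
    have qn: "4 * q \<le> n" using elim(6) q(3) n by simp
    have powP: "(1 / real P) ^ j \<le> real n powr (- (a * j))" for j
    proof -
      have "(1 / real P) ^ j \<le> (1 / real n powr a) ^ j"
        using P na n by (intro power_mono divide_left_mono mult_pos_pos) auto
      also have "\<dots> = (real n powr (- a)) powr j"
        using n by (simp add: powr_minus_divide powr_realpow)
      also have "\<dots> = real n powr (- (a * j))" by (simp add: powr_powr)
      finally show ?thesis .
    qed
    have npow: "real n ^ j = real n powr j" for j using n by (simp add: powr_realpow)
    have "real q ^ 2 * real K ^ k * real n ^ r * (1 / P) ^ (k * r)
      \<le> real n ^ 2 * (2 * real n powr (1 - u)) ^ k * real n ^ r * real n powr (- (a * (k * r)))"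
      using qn K powP[of "k * r"] by (intro mult_mono power_mono mult_nonneg_nonneg) auto
    also have "\<dots> = 2 ^ k * real n powr (2 + r + k * (1 - u) - a * (k * r))"
    proof -
      have "(real n powr (1 - u)) ^ k = real n powr (k * (1 - u))"
        using n by (simp add: powr_powr mult.commute flip: powr_realpow)
      then show ?thesis unfolding npow power_mult_distrib
        by (simp add: mult_ac algebra_simps del: powr_numeral flip: powr_add)
    qed
    also have "\<dots> < real n powr (- a) / 24" using elim(1) by simp
    finally have t1: "real q ^ 2 * real K ^ k * real n ^ r * (1 / P) ^ (k * r) < real n powr (- a) / 24" .
    have "real n ^ (s + r) * (1 / P) ^ d \<le> real n powr real (s + r) * real n powr (- (a * d))"
      unfolding npow using powP[of d] by (intro mult_left_mono) auto
    also have "\<dots> = real n powr (real (s + r) - a * d)" by (simp flip: powr_add)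
    also have "\<dots> < real n powr (- a) / 24" using elim(2) by simp
    finally have t2: "real n ^ (s + r) * (1 / P) ^ d < real n powr (- a) / 24" .
    have "real n powr (2 * u - a) / 8 = (real n powr u * real n powr u) / (4 * (2 * real n powr a))"
      by (simp add: powr_diff flip: powr_add)
    also have "\<dots> \<le> real q ^ 2 / (4 * P)"
      unfolding power2_eq_square using q P na by (intro frac_le mult_mono) auto
    finally have "2 ^ n * exp (- (real q ^ 2 / (4 * P))) \<le> 2 powr real n * exp (- (real n powr (2 * u - a) / 8))"
      by (simp add: powr_realpow)
    also note elim(3)
    finally have t3: "2 ^ n * exp (- (real q ^ 2 / (4 * P))) < real n powr (- a) / 24" .
    have "real n powr (- a) / 8 = 1 / (4 * (2 * real n powr a))" by (simp add: powr_minus_divide)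
    also have "\<dots> \<le> 1 / (4 * P)" using P n by (intro divide_left_mono mult_pos_pos) auto
    finally have small: "real q ^ 2 * real K ^ k * real n ^ r * (1 / P) ^ (k * r)
      + real n ^ (s + r) * (1 / P) ^ d + 2 ^ n * exp (- (real q ^ 2 / (4 * P))) < 1 / (4 * P)"
      using t1 t2 t3 by linarith
    have m: "8 * real q \<le> real n powr \<delta>" "2 * real q * \<kappa> \<le> real n powr \<delta>"
    proof -
      show "8 * real q \<le> real n powr \<delta>" using elim(4) q(3) by linarith
      have "2 * real \<kappa> * real q \<le> 2 * real \<kappa> * real n powr v" using q(3) by (intro mult_left_mono) auto
      then show "2 * real q * \<kappa> \<le> real n powr \<delta>" using elim(5) by (simp add: mult_ac)
    qed
    have "real n powr (2 - a) / 128 = real n ^ 2 / (64 * (2 * real n powr a))"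
      using n by (simp add: powr_diff powr_realpow)
    also have "\<dots> \<le> real n ^ 2 / (64 * P)" using P n by (intro divide_left_mono mult_pos_pos) auto
    also have "\<dots> \<le> real (RT s n (complete_graph (s + r)) (\<lambda>m. real m powr \<delta>))"
      using elim(8) by (intro RT_ge_plane[where f = "\<lambda>m. real m powr \<delta>", OF q(1) nq nK qn _ P(3) s k(2) m \<kappa> d(1) small])
    finally show ?case .
  qed
qed

end

theorem theorem4p3:
  fixes r :: nat and \<epsilon> \<delta> :: real
  assumes "r \<ge> 1"
    and "\<epsilon> > 0"
    and "1 / 2 + 1 / (2 * (2 * real r + 1)) < \<delta>"
    and "\<delta> < 1"
  shows "\<exists>s\<^sub>0. \<forall>s\<ge>s\<^sub>0.
    (\<lambda>n. real (RT s n (complete_graph (s + r)) (\<lambda>m. real m powr \<delta>)))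
      \<in> \<Omega>(\<lambda>n. real n powr (2 - (1 - \<delta>) / real r - \<epsilon>))"
proof -
  define b where "b = (1 - \<delta>) / real r"
  \<comment> \<open>After clearing denominators, this and the lower bound on \<open>\<delta>\<close>
    both say \<open>\<delta> * (2 * r + 1) > r + 1\<close>.\<close>
  have "2 * \<delta> - b > 1"
  proof -
    have "1 / 2 + 1 / (2 * (2 * real r + 1)) = (real r + 1) / (2 * real r + 1)"
      by (simp add: field_simps)
    then have "real r + 1 < \<delta> * (2 * real r + 1)" using assms(3) by (simp add: field_simps)
    then have "1 - \<delta> < (2 * \<delta> - 1) * real r" by (simp add: algebra_simps)
    then show ?thesis using assms(1) unfolding b_def by (simp add: field_simps)
  qed
  \<comment> \<open>Both uses of \<open>e\<close> together consume at most half of the slack in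
    \<open>2 * \<delta> - b > 1\<close>.\<close>
  define e where "e = min \<epsilon> ((2 * \<delta> - b - 1) / 4)"
  have e: "e > 0" "e \<le> \<epsilon>" "2 * \<delta> - (b + e) - e > 1"
    using \<open>2 * \<delta> - b > 1\<close> assms(2) unfolding e_def min_def by (auto simp: field_simps)
  define a where "a = b + e"
  have a0: "a > 0" using assms(1,4) e(1) unfolding a_def b_def by (intro add_nonneg_pos) auto
  \<comment> \<open>\<open>k\<close> is fixed before \<open>s\<close>, so \<open>C\<close> stays
    constant while \<open>s\<close> grows.\<close>
  obtain k :: nat where k: "k * (e / 2) > 2 + r + a" 
    using reals_Archimedean3[of "e / 2", THEN spec, of "2 + real r + a"] e(1) by auto
  then have k0: "k > 0" using a0 by (cases k) auto
  define C where "C = (k + r * r)\<^sup>2"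
  have C: "C > 0" using k0 by (simp add: C_def)
  \<comment> \<open>The available \<open>d\<close> is quadratic in \<open>N\<close> and the required
    one linear. Here \<open>d + 1 > N * (1 / a + 3)\<close>, so \<open>a * d\<close> exceeds
    \<open>N + 3 * a * N - a\<close>, which is at least \<open>N + 2 * a\<close>.\<close>
  obtain s0 :: nat where s0: "real C * (1 / a + 3) \<le> s0" using real_arch_simple by blast
  show ?thesis
  proof (intro exI[of _ "s0 + 2"] allI impI)
    fix s assume s: "s \<ge> s0 + 2"
    obtain \<kappa> where \<kappa>: "s * (1 - 1 / s) ^ \<kappa> \<le> 1 / 2" using exists_power_less[of s] s by auto
    define N where "N = s + r"
    define d where "d = N * (N - 1) div C"
    have "real C * (1 / a + 3) \<le> real (N - 1)" using s0 s assms(1) unfolding N_def by linarith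
    then have "real N * (real C * (1 / a + 3)) \<le> real N * real (N - 1)" by (intro mult_left_mono) auto
    also have "\<dots> = real (N * (N - 1))" by simp
    also have "\<dots> < real C * (real d + 1)"
    proof -
      have "N * (N - 1) < C * (d + 1)"
        unfolding d_def using C by (metis add.commute dividend_less_times_div mult_Suc_right plus_1_eq_Suc)
      then have "real (N * (N - 1)) < real (C * (d + 1))" by (rule of_nat_less_iff[THEN iffD2])
      then show ?thesis by (simp add: algebra_simps)
    qed
    finally have "real N * (1 / a + 3) < real d + 1" using C by (simp add: mult.left_commute)
    then have "a * (real N * (1 / a + 3)) < a * (real d + 1)" using a0 by simp
    then have "real N + 3 * (a * real N) < a * d + a" using a0 by (simp add: algebra_simps)
    moreover have "a * 1 \<le> a * real N" using a0 s unfolding N_def by (intro mult_left_mono) auto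
    ultimately have "a * d > real N + a" using a0 by linarith
    then have ad: "a * d > s + r + a" by (simp add: N_def)
    have d: "d * (k + r * r)\<^sup>2 \<le> (s + r) * (s + r - 1)"
      unfolding d_def N_def C_def[symmetric] by (rule div_times_less_eq_dividend)
    have "\<forall>\<^sub>F n in sequentially. real n powr (2 - a) / 128
        \<le> real (RT s n (complete_graph (s + r)) (\<lambda>m. real m powr \<delta>))"
    proof (rule eventually_RT_ge[OF assms(1) _ e(1) _ _ assms(4) k k0 \<kappa> d ad])
      show "s \<ge> 2" using s by simp
      show "a = (1 - \<delta>) / r + e" by (simp add: a_def b_def)
      show "2 * \<delta> - a - e > 1" using e(3) by (simp add: a_def)
    qed
    then have "\<forall>\<^sub>F n in sequentially. norm (real n powr (2 - (1 - \<delta>) / real r - \<epsilon>))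
        \<le> 128 * norm (real (RT s n (complete_graph (s + r)) (\<lambda>m. real m powr \<delta>)))"
      using eventually_ge_at_top[of 1]
    proof eventually_elim
      case (elim n)
      have "real n powr (2 - (1 - \<delta>) / real r - \<epsilon>) \<le> real n powr (2 - a)"
        using elim(2) e(2) unfolding a_def b_def by (intro powr_mono) auto
      then show ?case using elim(1) by simp
    qed
    then show "(\<lambda>n. real (RT s n (complete_graph (s + r)) (\<lambda>m. real m powr \<delta>)))
      \<in> \<Omega>(\<lambda>n. real n powr (2 - (1 - \<delta>) / real r - \<epsilon>))"
      by (subst bigomega_iff_bigo) (rule bigoI)
  qed
qed

end
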